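(* Let $n\geq1$. The two-sided Coxeter complex $\Xi(W,S)$ of the symmetric group $W=S_n$, with generating set $S=\{s_1,\ldots,s_{n-1}\}$ of adjacent transpositions, is isomorphic as a partially ordered set to the set $\Xi(n)$ of two-way contingency tables under refinement order.
   Context: Two-sided Coxeter complex: for a Coxeter system $(W,S)$ with length function $\ell$, and $J\subseteq S$, $W_J$ is the subgroup generated by $J$. Let $\mathrm{Asc}_L(w)=\{s\in S:\ell(sw)>\ell(w)\}$ and $\mathrm{Asc}_R(w)=\{s\in S:\ell(ws)>\ell(w)\}$. For $I,J\subseteq S$ let ${}^IW^J=\{w\in W: I\subseteq \mathrm{Asc}_L(w),\ J\subseteq\mathrm{Asc}_R(w)\}$, the set of minimal length representatives of the double cosets in $W_I\backslash W/W_J$. Then $\Xi(W,S)=\{(I,w,J): I,J\subseteq S,\ w\in{}^IW^J\}$, partially ordered by $(I,w,J)\leq_{\Xi}(I',w',J')$ if and only if $I\supseteq I'$, $J\supseteq J'$ and $W_IwW_J\supseteq W_{I'}w'W_{J'}$. For $W=S_n$, $s_i$ denotes the adjacent transposition $(i\ i+1)$. Contingency tables: $\Xi(n)$ is the set of all rectangular arrays (matrices, of any size $k\times l$ with $k,l\geq1$) of nonnegative integers whose entries sum to $n$ and whose row sums and column sums are all positive. Refinement order on $\Xi(n)$ is the partial order generated by the following covers: $A$ is covered by $B$ if $A$ is obtained from $B$ by replacing two adjacent rows by their (entrywise) sum, or by replacing two adjacent columns by their sum. Thus the minimum is the one-by-one array $[n]$ and the maximal elements are the $n\times n$ permutation matrices.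 *)

theory Defs
  imports "HOL-Algebra.Sym_Groups" "Jordan_Normal_Form.Matrix"
begin

definition poset_isomorphic ::
    "'a set \<Rightarrow> ('a \<Rightarrow> 'a \<Rightarrow> bool) \<Rightarrow> 'b set \<Rightarrow> ('b \<Rightarrow> 'b \<Rightarrow> bool) \<Rightarrow> bool" where
  "poset_isomorphic A le_A B le_B \<longleftrightarrow>
     partial_order_on A (relation_of le_A A) \<and>
     partial_order_on B (relation_of le_B B) \<and>
     (\<exists>f. bij_betw f A B \<and> (\<forall>x\<in>A. \<forall>y\<in>A. le_A x y \<longleftrightarrow> le_B (f x) (f y)))"

text \<open>
  In the following, \<open>G\<close> is a group and \<open>S\<close> a set of involutions generating it. The generators
  are their own inverses, so words over \<open>S\<close> itself suffice to define the length.
\<close>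

definition cox_length :: "('a, 'm) monoid_scheme \<Rightarrow> 'a set \<Rightarrow> 'a \<Rightarrow> nat" where
  "cox_length G S w =
     (LEAST k. \<exists>ss. set ss \<subseteq> S \<and> length ss = k \<and> foldr (\<otimes>\<^bsub>G\<^esub>) ss \<one>\<^bsub>G\<^esub> = w)"

definition left_ascents :: "('a, 'm) monoid_scheme \<Rightarrow> 'a set \<Rightarrow> 'a \<Rightarrow> 'a set" where
  "left_ascents G S w = {s \<in> S. cox_length G S (s \<otimes>\<^bsub>G\<^esub> w) > cox_length G S w}"

definition right_ascents :: "('a, 'm) monoid_scheme \<Rightarrow> 'a set \<Rightarrow> 'a \<Rightarrow> 'a set" where
  "right_ascents G S w = {s \<in> S. cox_length G S (w \<otimes>\<^bsub>G\<^esub> s) > cox_length G S w}"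

definition double_coset_reps ::
    "('a, 'm) monoid_scheme \<Rightarrow> 'a set \<Rightarrow> 'a set \<Rightarrow> 'a set \<Rightarrow> 'a set" where
  "double_coset_reps G S I J =
     {w \<in> carrier G. I \<subseteq> left_ascents G S w \<and> J \<subseteq> right_ascents G S w}"

definition parabolic_double_coset ::
    "('a, 'm) monoid_scheme \<Rightarrow> 'a set \<Rightarrow> 'a \<Rightarrow> 'a set \<Rightarrow> 'a set" where
  "parabolic_double_coset G I w J = (generate G I #>\<^bsub>G\<^esub> w) <#>\<^bsub>G\<^esub> generate G J"

definition two_sided_coxeter_complex ::
    "('a, 'm) monoid_scheme \<Rightarrow> 'a set \<Rightarrow> ('a set \<times> 'a \<times> 'a set) set" where
  "two_sided_coxeter_complex G S =
     {(I, w, J). I \<subseteq> S \<and> J \<subseteq> S \<and> w \<in> double_coset_reps G S I J}"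

definition two_sided_coxeter_le ::
    "('a, 'm) monoid_scheme \<Rightarrow> ('a set \<times> 'a \<times> 'a set) \<Rightarrow> ('a set \<times> 'a \<times> 'a set) \<Rightarrow> bool" where
  "two_sided_coxeter_le G = (\<lambda>(I, w, J) (I', w', J').
     I' \<subseteq> I \<and> J' \<subseteq> J \<and>
     parabolic_double_coset G I' w' J' \<subseteq> parabolic_double_coset G I w J)"

definition adjacent_transpositions :: "nat \<Rightarrow> (nat \<Rightarrow> nat) set" where
  "adjacent_transpositions n = (\<lambda>i. Transposition.transpose i (i + 1)) ` {1..<n}"

definition contingency_tables :: "nat \<Rightarrow> nat mat set" where
  "contingency_tables n =
     {A. dim_row A \<ge> 1 \<and> dim_col A \<ge> 1 \<and>
         (\<Sum>i<dim_row A. \<Sum>j<dim_col A. A $$ (i, j)) = n \<and>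
         (\<forall>i<dim_row A. (\<Sum>j<dim_col A. A $$ (i, j)) > 0) \<and>
         (\<forall>j<dim_col A. (\<Sum>i<dim_row A. A $$ (i, j)) > 0)}"

text \<open>Rows and columns are indexed from 0; the two merged lines are \<open>k\<close> and \<open>k + 1\<close>.\<close>

definition merge_rows :: "nat \<Rightarrow> nat mat \<Rightarrow> nat mat" where
  "merge_rows k A = mat (dim_row A - 1) (dim_col A) (\<lambda>(i, j).
     if i < k then A $$ (i, j)
     else if i = k then A $$ (k, j) + A $$ (k + 1, j)
     else A $$ (i + 1, j))"

definition merge_cols :: "nat \<Rightarrow> nat mat \<Rightarrow> nat mat" where
  "merge_cols k A = mat (dim_row A) (dim_col A - 1) (\<lambda>(i, j).
     if j < k then A $$ (i, j)
     else if j = k then A $$ (i, k) + A $$ (i, k + 1)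
     else A $$ (i, j + 1))"

definition refinement_cover :: "nat \<Rightarrow> nat mat \<Rightarrow> nat mat \<Rightarrow> bool" where
  "refinement_cover n A B \<longleftrightarrow>
     A \<in> contingency_tables n \<and> B \<in> contingency_tables n \<and>
     ((\<exists>k. k + 1 < dim_row B \<and> A = merge_rows k B) \<or>
      (\<exists>k. k + 1 < dim_col B \<and> A = merge_cols k B))"

definition refinement_le :: "nat \<Rightarrow> nat mat \<Rightarrow> nat mat \<Rightarrow> bool" where
  "refinement_le n = (refinement_cover n)\<^sup>*\<^sup>*"

end

theory Submission
  imports Defs
begin

text \<open>
  Encode \<open>I \<subseteq> S\<close> by the set \<open>C\<close> of indices \<open>i\<close> with \<open>s\<^sub>i \<notin> I\<close>, seen as cuts of the interval \<open>1, \<dots>, n\<close>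
  into consecutive blocks. The parabolic subgroup \<open>W\<^sub>I\<close> is then the Young subgroup of the permutations
  that preserve every block (\<open>generate_adj_eq_young\<close>). The isomorphism sends \<open>(I, w, J)\<close> to the block
  count of the permutation matrix of \<open>w\<close>: the entry \<open>(p, q)\<close> is the number of positions in the
  \<open>q\<close>-th block of \<open>J\<close> whose value lies in the \<open>p\<close>-th block of \<open>I\<close>.

  Three facts carry the proof. The first is that two permutations have the same table if and only if
  they lie in the same double coset of \<open>W\<^sub>I\<close> and \<open>W\<^sub>J\<close> (\<open>double_coset_eq_same_table\<close>): equal counts allow
  positions, and then values, to be matched block by block.

  The second is that the map is a bijection. The table determines the block sizes and thereby \<open>I\<close> and
  \<open>J\<close> (\<open>table_determines_cuts\<close>). Length is the number of inversions, so an ascent is an actual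
  increase, and the conditions on \<open>w\<close> say that \<open>w\<close> increases on the blocks of positions and its inverse on
  the blocks of values. There is one such \<open>w\<close> for each table (\<open>shortest_rep_unique\<close>,
  \<open>shortest_rep_exists\<close>), and every contingency table is the table of some permutation
  (\<open>contingency_table_is_table\<close>).

  The third is that deleting a cut merges two adjacent rows or columns, and that every merge arises so.
  The tables below that of \<open>(I', w', J')\<close> are therefore the tables of \<open>w'\<close> for subsets of the cuts
  (\<open>refinement_le_table_iff\<close>). By the first fact this is the order of the Coxeter complex: for
  \<open>I' \<subseteq> I\<close> and \<open>J' \<subseteq> J\<close>, the double coset of \<open>w'\<close> is contained in that of \<open>w\<close> exactly if \<open>w'\<close> and \<open>w\<close> have the
  same table with respect to \<open>I\<close> and \<open>J\<close>.
\<close>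

section \<open>Inversions and reduced words\<close>

abbreviation adj :: "nat \<Rightarrow> nat \<Rightarrow> nat" where
  "adj i \<equiv> Transposition.transpose i (Suc i)"

definition inversions :: "nat \<Rightarrow> (nat \<Rightarrow> nat) \<Rightarrow> (nat \<times> nat) set" where
  "inversions n w = {(x, y). 1 \<le> x \<and> x < y \<and> y \<le> n \<and> w y < w x}"

lemma finite_inversions: "finite (inversions n w)"
  by (rule finite_subset[of _ "{1..n} \<times> {1..n}"]) (auto simp: inversions_def)

lemma inversions_id: "inversions n id = {}"
  by (auto simp: inversions_def)

lemma adj_permutes: "1 \<le> i \<Longrightarrow> i < n \<Longrightarrow> adj i permutes {1..n}"
  by (rule permutes_swap_id) auto

lemma inj_adj: "inj adj"
proof (rule injI)
  fix i j :: nat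
  assume eq: "adj i = adj j"
  show "i = j"
  proof (rule ccontr)
    assume "i \<noteq> j"
    then show False
      using fun_cong[OF eq, of i] fun_cong[OF eq, of j]
      by (auto simp: transpose_def split: if_splits)
  qed
qed

text \<open>
  The step \<open>(i, i + 1)\<close> becomes an inversion; every other pair keeps the order of its positions
  when \<open>i\<close> and \<open>i + 1\<close> are exchanged, so the old inversions are merely renamed.
\<close>

lemma card_inversions_increase:
  assumes w: "w permutes {1..n}" and i: "1 \<le> i" "i < n" and less: "w i < w (Suc i)"
  shows "card (inversions n (w \<circ> adj i)) = Suc (card (inversions n w))"
proof -
  let ?f = "map_prod (adj i) (adj i)"
  have "inversions n (w \<circ> adj i) = insert (i, Suc i) (?f ` inversions n w)"
  proof (intro equalityI subsetI)
    fix z assume "z \<in> inversions n (w \<circ> adj i)"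
    then obtain x y where z: "z = (x, y)" "1 \<le> x" "x < y" "y \<le> n" "w (adj i y) < w (adj i x)"
      by (auto simp: inversions_def)
    show "z \<in> insert (i, Suc i) (?f ` inversions n w)"
    proof (cases "x = i \<and> y = Suc i")
      case False
      have "(adj i x, adj i y) \<in> inversions n w"
        using z i False by (auto simp: inversions_def transpose_def)
      then have "?f (adj i x, adj i y) \<in> ?f ` inversions n w" by (rule imageI)
      then show ?thesis using z by simp
    qed (use z in auto)
  next
    fix z assume "z \<in> insert (i, Suc i) (?f ` inversions n w)"
    then consider "z = (i, Suc i)"
      | x y where "z = (adj i x, adj i y)" "(x, y) \<in> inversions n w" by auto
    then show "z \<in> inversions n (w \<circ> adj i)"
    proof cases
      case 1
      then show ?thesis using i less by (auto simp: inversions_def)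
    next
      case 2
      then have "\<not> (x = i \<and> y = Suc i)" using less by (auto simp: inversions_def)
      then have "adj i x < adj i y" "1 \<le> adj i x" "adj i y \<le> n"
        using 2 i by (auto simp: inversions_def transpose_def)
      then show ?thesis using 2 by (simp add: inversions_def)
    qed
  qed
  moreover have "(i, Suc i) \<notin> ?f ` inversions n w"
    by (auto simp: inversions_def transpose_def split: if_splits)
  moreover have "inj ?f" by (simp add: prod.inj_map)
  then have "card (?f ` inversions n w) = card (inversions n w)"
    by (meson card_image inj_on_subset subset_UNIV)
  ultimately show ?thesis by (simp add: finite_inversions)
qed

lemma card_inversions_decrease:
  assumes w: "w permutes {1..n}" and i: "1 \<le> i" "i < n" and less: "w (Suc i) < w i"
  shows "Suc (card (inversions n (w \<circ> adj i))) = card (inversions n w)"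
proof -
  have "w \<circ> adj i permutes {1..n}"
    using permutes_compose[OF adj_permutes[OF i] w] .
  from card_inversions_increase[OF this i] less
  show ?thesis by (simp add: comp_assoc)
qed

lemma permutes_Suc_neq:
  fixes w :: "nat \<Rightarrow> nat"
  assumes "w permutes {1..n}"
  shows "w i \<noteq> w (Suc i)"
  using permutes_inj[OF assms] by (metis injD n_not_Suc_n)

lemma card_inversions_comp_adj_gt_iff:
  assumes w: "w permutes {1..n}" and i: "1 \<le> i" "i < n"
  shows "card (inversions n (w \<circ> adj i)) > card (inversions n w) \<longleftrightarrow> w i < w (Suc i)"
  using card_inversions_increase[OF assms] card_inversions_decrease[OF assms]
    permutes_Suc_neq[OF w, of i] by (cases "w i < w (Suc i)") auto

text \<open>
  Turning a pair of positions into the pair of their values exchanges the inversions of a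
  permutation with those of its inverse. This carries every statement on right multiplication,
  positions and columns over to left multiplication, values and rows.
\<close>

lemma card_inversions_inv:
  assumes w: "w permutes {1..n}"
  shows "card (inversions n (inv' w)) = card (inversions n w)"
proof -
  have "bij_betw (\<lambda>(x, y). (w y, w x)) (inversions n w) (inversions n (inv' w))"
    by (rule bij_betw_byWitness[where f' = "\<lambda>(x, y). (inv' w y, inv' w x)"])
      (use permutes_in_seg[OF w] permutes_in_seg[OF permutes_inv[OF w]] in
        \<open>auto simp: inversions_def permutes_inverses[OF w]\<close>)
  then show ?thesis by (simp add: bij_betw_same_card)
qed

lemma permutes_increasing_eq_id:
  fixes w :: "nat \<Rightarrow> nat"
  assumes w: "w permutes {1..n}" and incr: "\<And>i. 1 \<le> i \<Longrightarrow> i < n \<Longrightarrow> w i < w (Suc i)"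
  shows "w = id"
proof (rule permutes_natset_ge[OF w], rule ballI)
  fix x assume "x \<in> {1..n}"
  then have "1 \<le> x" "x \<le> n" by auto
  then show "x \<le> w x"
  proof (induction x rule: dec_induct)
    case base
    then show ?case using permutes_in_seg[OF w, of 1] by simp
  next
    case (step m)
    then show ?case using incr[of m] by simp
  qed
qed

section \<open>Blocks and Young subgroups\<close>

text \<open>
  A subset of the simple reflections is given by the set \<open>C\<close> of \<^emph>\<open>cuts\<close>: the indices \<open>i\<close> for which the
  reflection exchanging \<open>i\<close> and \<open>i + 1\<close> is missing. Cutting \<open>1, \<dots>, n\<close> behind every element of \<open>C\<close>
  leaves consecutive blocks, and \<open>block C x\<close> is the number, counted from 0, of the block of \<open>x\<close>.
\<close>

definition block :: "nat set \<Rightarrow> nat \<Rightarrow> nat" where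
  "block C x = card {c \<in> C. c < x}"

definition young :: "nat \<Rightarrow> nat set \<Rightarrow> (nat \<Rightarrow> nat) set" where
  "young n C = {p. p permutes {1..n} \<and> (\<forall>x\<in>{1..n}. block C (p x) = block C x)}"

lemma block_empty: "block {} x = 0"
  by (simp add: block_def)

lemma block_mono: "finite C \<Longrightarrow> x \<le> y \<Longrightarrow> block C x \<le> block C y"
  unfolding block_def by (rule card_mono) auto

lemma block_le_card: "finite C \<Longrightarrow> block C x \<le> card C"
  unfolding block_def by (rule card_mono) auto

lemma block_Suc: "finite C \<Longrightarrow> block C (Suc x) = (if x \<in> C then Suc (block C x) else block C x)"
proof -
  assume "finite C"
  moreover have "{c \<in> C. c < Suc x} = (if x \<in> C then insert x {c \<in> C. c < x} else {c \<in> C. c < x})"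
    by (auto simp: less_Suc_eq)
  ultimately show ?thesis by (simp add: block_def)
qed

lemma block_adj: "finite C \<Longrightarrow> i \<notin> C \<Longrightarrow> block C (adj i x) = block C x"
  by (auto simp: transpose_def block_Suc)

lemma adj_in_young:
  assumes "finite C" "i \<in> {1..<n} - C"
  shows "adj i \<in> young n C"
  using assms adj_permutes[of i n] by (auto simp: young_def block_adj)

lemma young_empty: "young n {} = {p. p permutes {1..n}}"
  by (auto simp: young_def block_empty)

lemma young_permutes: "p \<in> young n C \<Longrightarrow> p permutes {1..n}"
  by (simp add: young_def)

lemma young_id: "id \<in> young n C"
  by (auto simp: young_def permutes_id)

lemma young_comp:
  assumes "p \<in> young n C" "q \<in> young n C"
  shows "p \<circ> q \<in> young n C"
proof -
  have "q x \<in> {1..n}" if "x \<in> {1..n}" for x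
    using that permutes_in_image[OF young_permutes[OF assms(2)]] by blast
  then show ?thesis using assms by (auto simp: young_def permutes_compose)
qed

lemma young_inv:
  assumes "p \<in> young n C"
  shows "inv' p \<in> young n C"
proof -
  note p = young_permutes[OF assms]
  have "block C (inv' p x) = block C x" if "x \<in> {1..n}" for x
  proof -
    have "inv' p x \<in> {1..n}" using that permutes_in_image[OF permutes_inv[OF p]] by blast
    then have "block C (p (inv' p x)) = block C (inv' p x)" using assms by (auto simp: young_def)
    then show ?thesis by (simp add: permutes_inverses[OF p])
  qed
  then show ?thesis using permutes_inv[OF p] by (simp add: young_def)
qed

lemma foldr_comp_Nil: "foldr (\<circ>) [] id = id"
  by (simp add: fun_eq_iff)

lemma foldr_comp_Cons: "foldr (\<circ>) (s # ss) id = s \<circ> foldr (\<circ>) ss id"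
  by simp

lemma foldr_comp_permutes:
  "(\<And>s. s \<in> set ss \<Longrightarrow> s permutes A) \<Longrightarrow> foldr (\<circ>) ss id permutes A"
proof (induction ss)
  case Nil
  show ?case unfolding foldr_comp_Nil by (rule permutes_id)
next
  case (Cons s ss)
  have "foldr (\<circ>) ss id permutes A"
    by (rule Cons.IH) (rule Cons.prems, rule list.set_intros(2))
  moreover have "s permutes A"
    by (rule Cons.prems) (rule list.set_intros(1))
  ultimately have "s \<circ> foldr (\<circ>) ss id permutes A"
    by (rule permutes_compose)
  then show ?case unfolding foldr_comp_Cons .
qed

lemma foldr_comp_append:
  "foldr (\<circ>) (ss @ [s]) id = foldr (\<circ>) ss id \<circ> s"
  by (induction ss) (auto simp: comp_assoc)

text \<open>
  Sorting by adjacent exchanges. A descent \<open>p i > p (i + 1)\<close> of a block preserving \<open>p\<close> cannot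
  straddle a cut, because block numbers weakly increase along the positions; so the exchange that
  removes it stays inside the Young subgroup and costs one letter per inversion. The case of no cuts
  yields short words for all permutations, the general case yields generation of Young subgroups.
\<close>

lemma young_word:
  assumes "p \<in> young n C" and C: "finite C"
  shows "\<exists>ss. set ss \<subseteq> adj ` ({1..<n} - C) \<and> length ss = card (inversions n p) \<and> foldr (\<circ>) ss id = p"
  using assms(1)
proof (induction "card (inversions n p)" arbitrary: p rule: less_induct)
  case less
  note p = young_permutes[OF less.prems]
  show ?case
  proof (cases "p = id")
    case True
    then show ?thesis by (intro exI[of _ "[]"]) (simp add: inversions_id)
  next
    case False
    then obtain i where i: "1 \<le> i" "i < n" and "\<not> p i < p (Suc i)"
      using permutes_increasing_eq_id[OF p] by auto
    then have desc: "p (Suc i) < p i" using permutes_Suc_neq[OF p, of i] by simp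
    have "block C i = block C (p i)" "block C (p (Suc i)) = block C (Suc i)"
      using less.prems i by (auto simp: young_def)
    moreover have "block C (p (Suc i)) \<le> block C (p i)" using desc C by (simp add: block_mono)
    ultimately have "i \<notin> C" using C by (auto simp: block_Suc split: if_splits)
    with i have iC: "i \<in> {1..<n} - C" by auto
    let ?q = "p \<circ> adj i"
    have q: "?q \<in> young n C" using young_comp[OF less.prems adj_in_young[OF C iC]] .
    have "Suc (card (inversions n ?q)) = card (inversions n p)"
      using card_inversions_decrease[OF p i desc] .
    moreover from this obtain ss where "set ss \<subseteq> adj ` ({1..<n} - C)"
      "length ss = card (inversions n ?q)" "foldr (\<circ>) ss id = ?q"
      using less.hyps[OF _ q] by auto
    ultimately have "set (ss @ [adj i]) \<subseteq> adj ` ({1..<n} - C)"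
      "length (ss @ [adj i]) = card (inversions n p)" "foldr (\<circ>) (ss @ [adj i]) id = p"
      using iC by (auto simp: foldr_comp_append comp_assoc simp del: foldr_append)
    then show ?thesis by blast
  qed
qed

lemma generate_adj_eq_young:
  assumes C: "finite C"
  shows "generate (sym_group n) (adj ` ({1..<n} - C)) = young n C"
proof (intro equalityI subsetI)
  fix p assume "p \<in> generate (sym_group n) (adj ` ({1..<n} - C))"
  then show "p \<in> young n C"
  proof induction
    case one
    show ?case unfolding sym_group_one by (rule young_id)
  next
    case (incl h)
    then show ?case using adj_in_young[OF C] by auto
  next
    case (inv h)
    then have h: "h \<in> young n C" using adj_in_young[OF C] by auto
    then show ?case using young_inv[OF h] young_permutes[OF h]
      by (simp add: sym_group_inv_equality sym_group_carrier)
  next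
    case (eng h1 h2)
    then show ?case unfolding sym_group_mult by (intro young_comp)
  qed
next
  fix p assume "p \<in> young n C"
  then obtain ss where "set ss \<subseteq> adj ` ({1..<n} - C)" and p: "foldr (\<circ>) ss id = p"
    using young_word[OF _ C] by blast
  from this(1) have "foldr (\<circ>) ss id \<in> generate (sym_group n) (adj ` ({1..<n} - C))"
  proof (induction ss)
    case Nil
    show ?case using generate.one[of "sym_group n"] unfolding sym_group_one foldr_comp_Nil .
  next
    case (Cons s ss)
    have "s \<in> generate (sym_group n) (adj ` ({1..<n} - C))"
      using Cons.prems by (intro generate.incl) (meson list.set_intros(1) subsetD)
    moreover have "foldr (\<circ>) ss id \<in> generate (sym_group n) (adj ` ({1..<n} - C))"
      by (rule Cons.IH) (use Cons.prems in \<open>simp_all only: list.set insert_subset\<close>)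
    ultimately have "mult (sym_group n) s (foldr (\<circ>) ss id) \<in> generate (sym_group n) (adj ` ({1..<n} - C))"
      by (rule generate.eng)
    then show ?case unfolding sym_group_mult foldr_comp_Cons .
  qed
  with p show "p \<in> generate (sym_group n) (adj ` ({1..<n} - C))" by simp
qed

section \<open>Length and ascents in the symmetric group\<close>

lemma adjacent_transpositions_eq: "adjacent_transpositions n = adj ` ({1..<n} - {})"
  by (simp add: adjacent_transpositions_def)

lemma card_inversions_word_le:
  assumes "set ss \<subseteq> adjacent_transpositions n"
  shows "card (inversions n (foldr (\<circ>) ss id)) \<le> length ss"
  using assms
proof (induction ss rule: rev_induct)
  case Nil
  then show ?case unfolding foldr_comp_Nil inversions_id by simp
next
  case (snoc s ss)
  let ?p = "foldr (\<circ>) ss id"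
  from snoc.prems obtain i where i: "1 \<le> i" "i < n" "s = adj i"
    by (auto simp: adjacent_transpositions_def)
  have p: "?p permutes {1..n}"
  proof (rule foldr_comp_permutes)
    fix s' assume "s' \<in> set ss"
    then have "s' \<in> adjacent_transpositions n" using snoc.prems by auto
    then obtain j where "1 \<le> j" "j < n" "s' = adj j"
      by (auto simp: adjacent_transpositions_def)
    then show "s' permutes {1..n}" using adj_permutes by blast
  qed
  have "card (inversions n (?p \<circ> adj i)) \<le> Suc (card (inversions n ?p))"
    using card_inversions_increase[OF p i(1,2)] card_inversions_decrease[OF p i(1,2)]
      permutes_Suc_neq[OF p, of i] by (cases "?p i < ?p (Suc i)") auto
  also have "card (inversions n ?p) \<le> length ss"
    by (rule snoc.IH) (use snoc.prems in simp)
  finally show ?case unfolding foldr_comp_append i(3) length_append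
    by (simp only: list.size add_0 add_0_right add_Suc_right)
qed

text \<open>
  A letter changes the number of inversions by one, so no word is shorter than this number; sorting
  provides a word that attains it.
\<close>

lemma cox_length_eq_card_inversions:
  assumes "w permutes {1..n}"
  shows "cox_length (sym_group n) (adjacent_transpositions n) w = card (inversions n w)"
  unfolding cox_length_def
proof (rule Least_equality)
  have "w \<in> young n {}" using assms by (simp add: young_empty)
  from young_word[OF this]
  show "\<exists>ss. set ss \<subseteq> adjacent_transpositions n \<and> length ss = card (inversions n w) \<and>
      foldr (\<otimes>\<^bsub>sym_group n\<^esub>) ss \<one>\<^bsub>sym_group n\<^esub> = w"
    by (simp add: adjacent_transpositions_eq sym_group_mult sym_group_one)
next
  fix k assume "\<exists>ss. set ss \<subseteq> adjacent_transpositions n \<and> length ss = k \<and>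
      foldr (\<otimes>\<^bsub>sym_group n\<^esub>) ss \<one>\<^bsub>sym_group n\<^esub> = w"
  then show "card (inversions n w) \<le> k"
    using card_inversions_word_le by (auto simp: sym_group_mult sym_group_one)
qed

lemma right_ascents_sym_group:
  assumes w: "w permutes {1..n}"
  shows "right_ascents (sym_group n) (adjacent_transpositions n) w
    = adj ` {i \<in> {1..<n}. w i < w (Suc i)}"
proof -
  have "cox_length (sym_group n) (adjacent_transpositions n) (w \<circ> adj i)
      > cox_length (sym_group n) (adjacent_transpositions n) w \<longleftrightarrow> w i < w (Suc i)"
    if "i \<in> {1..<n}" for i
    using that w card_inversions_comp_adj_gt_iff[OF w, of i]
      permutes_compose[OF adj_permutes[of i n] w]
    by (simp add: cox_length_eq_card_inversions)
  then show ?thesis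
    by (auto simp: right_ascents_def sym_group_mult adjacent_transpositions_def)
qed

lemma inv_adj_comp:
  assumes w: "w permutes {1..n}"
  shows "inv' (adj i \<circ> w) = inv' w \<circ> adj i"
  using permutes_bij[OF w] by (simp add: o_inv_distrib)

lemma left_ascents_sym_group:
  assumes w: "w permutes {1..n}"
  shows "left_ascents (sym_group n) (adjacent_transpositions n) w
    = adj ` {i \<in> {1..<n}. inv' w i < inv' w (Suc i)}"
proof -
  note w' = permutes_inv[OF w]
  have "cox_length (sym_group n) (adjacent_transpositions n) (adj i \<circ> w)
      > cox_length (sym_group n) (adjacent_transpositions n) w \<longleftrightarrow> inv' w i < inv' w (Suc i)"
    if "i \<in> {1..<n}" for i
  proof -
    have sw: "adj i \<circ> w permutes {1..n}"
      using that by (intro permutes_compose[OF w] adj_permutes) auto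
    have "card (inversions n (adj i \<circ> w)) = card (inversions n (inv' w \<circ> adj i))"
      using card_inversions_inv[OF sw] unfolding inv_adj_comp[OF w] by simp
    then show ?thesis
      using that card_inversions_comp_adj_gt_iff[OF w', of i] card_inversions_inv[OF w]
      by (simp add: cox_length_eq_card_inversions[OF sw] cox_length_eq_card_inversions[OF w])
  qed
  then show ?thesis
    by (auto simp: left_ascents_def sym_group_mult adjacent_transpositions_def)
qed

section \<open>The contingency table of a double coset\<close>

text \<open>
  The entry \<open>(p, q)\<close> counts the ones of the permutation matrix of \<open>w\<close> in the block of rows \<open>p\<close> and
  columns \<open>q\<close>, where \<open>C\<close> cuts the values and \<open>D\<close> the positions.
\<close>

definition table :: "nat \<Rightarrow> nat set \<Rightarrow> (nat \<Rightarrow> nat) \<Rightarrow> nat set \<Rightarrow> nat mat" where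
  "table n C w D = mat (Suc (card C)) (Suc (card D))
     (\<lambda>(p, q). card {x \<in> {1..n}. block C (w x) = p \<and> block D x = q})"

lemma dim_table [simp]:
  "dim_row (table n C w D) = Suc (card C)" "dim_col (table n C w D) = Suc (card D)"
  by (simp_all add: table_def)

lemma index_table:
  "p \<le> card C \<Longrightarrow> q \<le> card D \<Longrightarrow>
    table n C w D $$ (p, q) = card {x \<in> {1..n}. block C (w x) = p \<and> block D x = q}"
  by (simp add: table_def)

lemma equal_fibre_cards_imp_permutation:
  assumes "finite A" and card: "\<And>p. card {x \<in> A. f x = p} = card {x \<in> A. g x = p}"
  obtains \<tau> where "\<tau> permutes A" "\<forall>x\<in>A. f x = g (\<tau> x)"
proof (rule image_mset_eq_implies_permutes[OF \<open>finite A\<close>])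
  have *: "count (image_mset h (mset_set A)) p = card {x \<in> A. h x = p}" for h p
    using \<open>finite A\<close> by (simp add: count_image_mset' eq_commute)
  show "image_mset f (mset_set A) = image_mset g (mset_set A)"
    by (rule multiset_eqI) (simp only: * card)
qed

text \<open>
  A table records the sizes of the fibres of \<open>x \<mapsto> (block C (v x), block D x)\<close>. Two functions on a
  finite set with fibres of equal size differ by a permutation of that set, and this permutation is
  what all later comparisons of tables work with.
\<close>

lemma table_eq_imp_permutation:
  assumes fin: "finite C" "finite D" "finite C'" "finite D'"
    and eq: "table n C v D = table n C' w D'"
  obtains \<tau> where "\<tau> permutes {1..n}"
    "\<And>x. x \<in> {1..n} \<Longrightarrow> block C (v x) = block C' (w (\<tau> x))"
    "\<And>x. x \<in> {1..n} \<Longrightarrow> block D x = block D' (\<tau> x)"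
proof -
  let ?f = "\<lambda>x. (block C (v x), block D x)" and ?g = "\<lambda>x. (block C' (w x), block D' x)"
  have dims: "card C = card C'" "card D = card D'"
    using arg_cong[OF eq, of dim_row] arg_cong[OF eq, of dim_col] by simp_all
  have card_eq: "card {x \<in> {1..n}. ?f x = pq} = card {x \<in> {1..n}. ?g x = pq}" for pq
  proof (cases "fst pq \<le> card C \<and> snd pq \<le> card D")
    case True
    then show ?thesis
      using arg_cong[OF eq, of "\<lambda>A. A $$ pq"] dims index_table[of "fst pq" C "snd pq" D n v]
        index_table[of "fst pq" C' "snd pq" D' n w]
      by (simp add: prod_eq_iff)
  next
    case False
    have "{x \<in> {1..n}. ?f x = pq} = {}" "{x \<in> {1..n}. ?g x = pq} = {}"
      using False dims block_le_card[OF fin(1)] block_le_card[OF fin(2)]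
        block_le_card[OF fin(3)] block_le_card[OF fin(4)] by auto
    then show ?thesis by (simp only:)
  qed
  show thesis
    by (rule equal_fibre_cards_imp_permutation[of "{1..n}" ?f ?g, OF _ card_eq])
      (use that in auto)
qed

lemma permutation_imp_table_eq:
  assumes \<tau>: "\<tau> permutes {1..n}"
    and C: "\<And>x. x \<in> {1..n} \<Longrightarrow> block C (v x) = block C (w (\<tau> x))"
    and D: "\<And>x. x \<in> {1..n} \<Longrightarrow> block D x = block D (\<tau> x)"
  shows "table n C v D = table n C w D"
proof (rule eq_matI)
  fix p q assume pq: "p < dim_row (table n C w D)" "q < dim_col (table n C w D)"
  have "bij_betw \<tau> {x \<in> {1..n}. block C (v x) = p \<and> block D x = q}
      {x \<in> {1..n}. block C (w x) = p \<and> block D x = q}"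
    unfolding bij_betw_def
  proof (intro conjI equalityI subsetI)
    show "inj_on \<tau> {x \<in> {1..n}. block C (v x) = p \<and> block D x = q}"
      using permutes_inj[OF \<tau>] by (rule inj_on_subset) simp
  next
    fix y assume "y \<in> \<tau> ` {x \<in> {1..n}. block C (v x) = p \<and> block D x = q}"
    then obtain x where x: "y = \<tau> x" "x \<in> {1..n}" "block C (v x) = p" "block D x = q"
      by blast
    moreover have "y \<in> {1..n}" using x permutes_in_image[OF \<tau>] by blast
    ultimately show "y \<in> {x \<in> {1..n}. block C (w x) = p \<and> block D x = q}"
      using C[of x] D[of x] by simp
  next
    fix y assume y: "y \<in> {x \<in> {1..n}. block C (w x) = p \<and> block D x = q}"
    then have "y \<in> \<tau> ` {1..n}" using permutes_image[OF \<tau>] by auto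
    then obtain x where "y = \<tau> x" "x \<in> {1..n}" by blast
    then show "y \<in> \<tau> ` {x \<in> {1..n}. block C (v x) = p \<and> block D x = q}"
      using y C[of x] D[of x] by auto
  qed
  then show "table n C v D $$ (p, q) = table n C w D $$ (p, q)"
    using pq by (simp add: index_table less_Suc_eq_le bij_betw_same_card)
qed simp_all

lemma table_young_comp:
  assumes w: "w permutes {1..n}" and u: "u \<in> young n C" and v: "v \<in> young n D"
  shows "table n C (u \<circ> w \<circ> v) D = table n C w D"
proof (rule permutation_imp_table_eq[OF young_permutes[OF v]])
  fix x assume x: "x \<in> {1..n}"
  have "w (v x) \<in> {1..n}"
    using x permutes_in_image[OF w] permutes_in_image[OF young_permutes[OF v]] by blast
  then show "block C ((u \<circ> w \<circ> v) x) = block C (w (v x))"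
    using u by (simp add: young_def)
  show "block D x = block D (v x)" using x v by (simp add: young_def)
qed

text \<open>
  The rearrangement \<open>\<tau>\<close> of positions that matches the two tables preserves the blocks of \<open>D\<close>, and the
  permutation of values that carries \<open>w \<circ> \<tau>\<close> to \<open>v\<close> preserves the blocks of \<open>C\<close>.
\<close>

lemma same_table_imp_young_factors:
  assumes w: "w permutes {1..n}" and v: "v permutes {1..n}"
    and fin: "finite C" "finite D" and eq: "table n C v D = table n C w D"
  obtains u u' where "u \<in> young n C" "u' \<in> young n D" "v = u \<circ> w \<circ> u'"
proof -
  obtain \<tau> where \<tau>: "\<tau> permutes {1..n}"
    and C: "\<And>x. x \<in> {1..n} \<Longrightarrow> block C (v x) = block C (w (\<tau> x))"
    and D: "\<And>x. x \<in> {1..n} \<Longrightarrow> block D x = block D (\<tau> x)"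
    using table_eq_imp_permutation[OF fin fin eq] by blast
  let ?t = "w \<circ> \<tau>"
  have t: "?t permutes {1..n}" using permutes_compose[OF \<tau> w] .
  let ?u = "v \<circ> inv' ?t"
  have u: "?u permutes {1..n}" using permutes_compose[OF permutes_inv[OF t] v] .
  have "block C (?u y) = block C y" if "y \<in> {1..n}" for y
  proof -
    have "inv' ?t y \<in> {1..n}" using that permutes_in_image[OF permutes_inv[OF t]] by blast
    from C[OF this] have "block C (?u y) = block C (?t (inv' ?t y))" by simp
    then show ?thesis by (simp only: permutes_inverses[OF t])
  qed
  then have "?u \<in> young n C" using u by (simp add: young_def)
  moreover have "\<tau> \<in> young n D" using \<tau> D by (simp add: young_def)
  moreover have "v = ?u \<circ> w \<circ> \<tau>"
  proof
    fix x
    have "(?u \<circ> w \<circ> \<tau>) x = v (inv' ?t (?t x))" by simp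
    also have "\<dots> = v x" by (simp only: permutes_inverses[OF t])
    finally show "v x = (?u \<circ> w \<circ> \<tau>) x" ..
  qed
  ultimately show thesis by (rule that)
qed

lemma Union_of_products:
  "(\<Union>h\<in>(\<Union>u\<in>A. {f u}). \<Union>v\<in>B. {g h v}) = {g (f u) v | u v. u \<in> A \<and> v \<in> B}"
  by blast

lemma double_coset_eq_same_table:
  assumes w: "w permutes {1..n}" and C: "finite C" and D: "finite D"
  shows "parabolic_double_coset (sym_group n) (adj ` ({1..<n} - C)) w (adj ` ({1..<n} - D))
    = {v. v permutes {1..n} \<and> table n C v D = table n C w D}" (is "?L = ?R")
proof -
  have "?L = (\<Union>h\<in>(\<Union>u\<in>young n C. {u \<circ> w}). \<Union>v\<in>young n D. {h \<circ> v})"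
    unfolding parabolic_double_coset_def generate_adj_eq_young[OF C] generate_adj_eq_young[OF D]
      r_coset_def set_mult_def sym_group_mult ..
  also have "\<dots> = {u \<circ> w \<circ> v | u v. u \<in> young n C \<and> v \<in> young n D}"
    by (rule Union_of_products)
  also have "\<dots> = ?R"
  proof (intro equalityI subsetI)
    fix z assume "z \<in> {u \<circ> w \<circ> v | u v. u \<in> young n C \<and> v \<in> young n D}"
    then obtain u v where "z = u \<circ> w \<circ> v" "u \<in> young n C" "v \<in> young n D" by blast
    moreover from this have "u \<circ> w \<circ> v permutes {1..n}"
      by (intro permutes_compose[OF young_permutes permutes_compose[OF w young_permutes]])
    ultimately show "z \<in> ?R"
      using table_young_comp[OF w] by blast
  next
    fix z assume "z \<in> ?R"
    then have "z permutes {1..n}" "table n C z D = table n C w D" by auto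
    then obtain u u' where "u \<in> young n C" "u' \<in> young n D" "z = u \<circ> w \<circ> u'"
      by (rule same_table_imp_young_factors[OF w _ C D])
    then show "z \<in> {u \<circ> w \<circ> v | u v. u \<in> young n C \<and> v \<in> young n D}" by blast
  qed
  finally show ?thesis .
qed

section \<open>Tables determine the cuts and the shortest representative\<close>

text \<open>
  A weakly increasing function on a finite set of numbers is determined by its multiset of values:
  its set of arguments with value at most \<open>p\<close> is an initial segment, whose size the values fix.
\<close>

lemma monotone_rearrangement_unique:
  fixes f g :: "nat \<Rightarrow> nat"
  assumes X: "finite X" and \<tau>: "bij_betw \<tau> X X" and fg: "\<And>x. x \<in> X \<Longrightarrow> f x = g (\<tau> x)"
    and f: "\<And>x y. x \<in> X \<Longrightarrow> y \<in> X \<Longrightarrow> x \<le> y \<Longrightarrow> f x \<le> f y"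
    and g: "\<And>x y. x \<in> X \<Longrightarrow> y \<in> X \<Longrightarrow> x \<le> y \<Longrightarrow> g x \<le> g y"
    and x: "x \<in> X"
  shows "f x = g x"
proof -
  have cards: "card {y \<in> X. f y \<le> p} = card {y \<in> X. g y \<le> p}" for p
  proof (rule bij_betw_same_card[of \<tau>], rule bij_betw_imageI)
    show "inj_on \<tau> {y \<in> X. f y \<le> p}"
      using \<tau> unfolding bij_betw_def by (blast intro: inj_on_subset)
    show "\<tau> ` {y \<in> X. f y \<le> p} = {y \<in> X. g y \<le> p}"
    proof (intro equalityI subsetI)
      fix z assume "z \<in> \<tau> ` {y \<in> X. f y \<le> p}"
      then obtain y where "z = \<tau> y" "y \<in> X" "f y \<le> p" by blast
      then show "z \<in> {y \<in> X. g y \<le> p}" using fg bij_betwE[OF \<tau>] by simp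
    next
      fix z assume z: "z \<in> {y \<in> X. g y \<le> p}"
      then obtain y where "z = \<tau> y" "y \<in> X" using bij_betw_imp_surj_on[OF \<tau>] by blast
      then show "z \<in> \<tau> ` {y \<in> X. f y \<le> p}" using z fg by simp
    qed
  qed
  have main: "\<not> h x < k x"
    if "\<And>p. card {y \<in> X. h y \<le> p} = card {y \<in> X. k y \<le> p}"
      "\<And>x y. x \<in> X \<Longrightarrow> y \<in> X \<Longrightarrow> x \<le> y \<Longrightarrow> h x \<le> h y"
      "\<And>x y. x \<in> X \<Longrightarrow> y \<in> X \<Longrightarrow> x \<le> y \<Longrightarrow> k x \<le> k y" for h k :: "nat \<Rightarrow> nat"
  proof
    assume less: "h x < k x"
    \<comment> \<open>At the threshold \<open>h x\<close>, the sublevel set of \<open>h\<close> reaches up to \<open>x\<close>, while that of \<open>k\<close> stops before \<open>x\<close>.\<close>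
    have "{y \<in> X. k y \<le> h x} \<subset> {y \<in> X. h y \<le> h x}"
    proof (rule psubsetI)
      show "{y \<in> X. k y \<le> h x} \<subseteq> {y \<in> X. h y \<le> h x}"
      proof
        fix y assume y: "y \<in> {y \<in> X. k y \<le> h x}"
        then have "\<not> x \<le> y" using that(3)[OF x, of y] less by auto
        then show "y \<in> {y \<in> X. h y \<le> h x}" using that(2)[of y x] x y by auto
      qed
      have "x \<in> {y \<in> X. h y \<le> h x}" "x \<notin> {y \<in> X. k y \<le> h x}" using x less by simp_all
      then show "{y \<in> X. k y \<le> h x} \<noteq> {y \<in> X. h y \<le> h x}" by blast
    qed
    then have "card {y \<in> X. k y \<le> h x} < card {y \<in> X. h y \<le> h x}"
      using X by (intro psubset_card_mono) auto
    then show False using that(1)[of "h x"] by simp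
  qed
  have "\<not> f x < g x" using cards f g by (rule main)
  moreover have "\<not> g x < f x" using cards[symmetric] g f by (rule main)
  ultimately show ?thesis by simp
qed

lemma block_determines_cuts:
  assumes C: "C \<subseteq> {1..<n}" and C': "C' \<subseteq> {1..<n}"
    and eq: "\<And>x. x \<in> {1..n} \<Longrightarrow> block C x = block C' x"
  shows "C = C'"
proof -
  have "i \<in> C \<longleftrightarrow> i \<in> C'" if "i \<in> {1..<n}" for i
    using eq[of i] eq[of "Suc i"] that finite_subset[OF C] finite_subset[OF C']
    by (auto simp: block_Suc split: if_splits)
  then show ?thesis using C C' by blast
qed

lemma permutes_interval_closed:
  assumes "x \<in> {1..n}" "w permutes {1..n}"
  shows "inv' w x \<in> {1..n}" "w x \<in> {1..n}"
  using assms permutes_in_image[OF assms(2)] permutes_in_image[OF permutes_inv[OF assms(2)]] by blast+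

text \<open>
  Row and column sums of a table are the block sizes, and these determine the cuts. Instead of
  summing, the argument applies the uniqueness of weakly increasing rearrangements to the block
  numbers.
\<close>

lemma table_determines_cuts:
  assumes C: "C \<subseteq> {1..<n}" "C' \<subseteq> {1..<n}" and D: "D \<subseteq> {1..<n}" "D' \<subseteq> {1..<n}"
    and v: "v permutes {1..n}" and w: "w permutes {1..n}"
    and eq: "table n C v D = table n C' w D'"
  shows "C = C'" "D = D'"
proof -
  have fin: "finite C" "finite D" "finite C'" "finite D'"
    using C D by (auto intro: finite_subset)
  obtain \<tau> where \<tau>: "\<tau> permutes {1..n}"
    and bC: "\<And>x. x \<in> {1..n} \<Longrightarrow> block C (v x) = block C' (w (\<tau> x))"
    and bD: "\<And>x. x \<in> {1..n} \<Longrightarrow> block D x = block D' (\<tau> x)"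
    using table_eq_imp_permutation[OF fin eq] by blast
  show "D = D'"
  proof (rule block_determines_cuts[OF D])
    fix x assume "x \<in> {1..n}"
    then show "block D x = block D' x"
      using monotone_rearrangement_unique[of "{1..n}" \<tau> "block D" "block D'" x]
        permutes_imp_bij[OF \<tau>] bD block_mono fin by blast
  qed
  have \<sigma>: "w \<circ> \<tau> \<circ> inv' v permutes {1..n}"
    by (intro permutes_compose permutes_inv v w \<tau>)
  have bC': "block C y = block C' ((w \<circ> \<tau> \<circ> inv' v) y)" if "y \<in> {1..n}" for y
    using bC[of "inv' v y"] permutes_interval_closed[OF that v] by (simp add: permutes_inverses[OF v])
  show "C = C'"
  proof (rule block_determines_cuts[OF C])
    fix x assume "x \<in> {1..n}"
    then show "block C x = block C' x"
      using monotone_rearrangement_unique[of "{1..n}" "w \<circ> \<tau> \<circ> inv' v" "block C" "block C'" x]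
        permutes_imp_bij[OF \<sigma>] bC' block_mono fin by blast
  qed
qed

text \<open>
  The representatives of minimal length, with ascents expressed by values: increasing within the
  blocks of positions, and with inverse increasing within the blocks of values.
\<close>

definition shortest_reps :: "nat \<Rightarrow> nat set \<Rightarrow> nat set \<Rightarrow> (nat \<Rightarrow> nat) set" where
  "shortest_reps n C D = {w. w permutes {1..n} \<and> (\<forall>i\<in>{1..<n} - D. w i < w (Suc i)) \<and>
     (\<forall>i\<in>{1..<n} - C. inv' w i < inv' w (Suc i))}"

lemma shortest_repsD:
  assumes "w \<in> shortest_reps n C D"
  shows "w permutes {1..n}" "\<forall>i\<in>{1..<n} - D. w i < w (Suc i)"
    "\<forall>i\<in>{1..<n} - C. inv' w i < inv' w (Suc i)"
  using assms unfolding shortest_reps_def by blast+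

lemma increasing_on_blocks:
  assumes C: "finite C" and incr: "\<forall>i\<in>{1..<n} - C. w i < w (Suc i)"
    and x: "1 \<le> x" and xy: "x < y" "y \<le> n" and blk: "block C x = block C y"
  shows "w x < (w y :: nat)"
proof -
  have step: "w z < w (Suc z)" if "x \<le> z" "z < y" for z
  proof -
    have "block C x \<le> block C z" "block C z \<le> block C (Suc z)" "block C (Suc z) \<le> block C y"
      using that C by (simp_all add: block_mono)
    then have "z \<notin> C" using blk C by (auto simp: block_Suc split: if_splits)
    then show ?thesis using incr that x xy by auto
  qed
  have "Suc x \<le> y" using xy by simp
  then show ?thesis using step
  proof (induction y rule: dec_induct)
    case (step m)
    then have "w x < w m" by simp
    also have "w m < w (Suc m)" using step by simp
    finally show ?case .
  qed simp
qed

text \<open>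
  Within a block of positions the values increase, so their block numbers weakly increase, and the table
  says how often each occurs: thus \<open>v\<close> and \<open>w\<close> send each position to the same block of values.
  Inside one block of values the order of the values is the order of the positions. Both facts
  together fix the relative order of all values, hence the permutation.
\<close>

lemma shortest_rep_unique:
  assumes C: "finite C" and D: "finite D"
    and v: "v \<in> shortest_reps n C D" and w: "w \<in> shortest_reps n C D"
    and eq: "table n C v D = table n C w D"
  shows "v = w"
proof -
  have vp: "v permutes {1..n}" and wp: "w permutes {1..n}"
    using shortest_repsD(1)[OF v] shortest_repsD(1)[OF w] by blast+
  obtain \<tau> where \<tau>: "\<tau> permutes {1..n}"
    and bC: "\<And>x. x \<in> {1..n} \<Longrightarrow> block C (v x) = block C (w (\<tau> x))"
    and bD: "\<And>x. x \<in> {1..n} \<Longrightarrow> block D x = block D (\<tau> x)"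
    using table_eq_imp_permutation[OF C D C D eq] by blast
  have mono: "block C (u x) \<le> block C (u y)"
    if "u \<in> shortest_reps n C D" "x \<in> {1..n}" "y \<in> {1..n}" "block D x = block D y" "x \<le> y" for u x y
  proof (cases "x = y")
    case False
    then have "u x < u y"
      using that(2-5) by (intro increasing_on_blocks[OF D shortest_repsD(2)[OF that(1)]]) simp_all
    then show ?thesis using C by (simp add: block_mono)
  qed simp
  have same: "block C (v x) = block C (w x)" if x: "x \<in> {1..n}" for x
  proof -
    let ?X = "{z \<in> {1..n}. block D z = block D x}"
    have "bij_betw \<tau> ?X ?X"
    proof (rule bij_betw_byWitness[where f' = "inv' \<tau>"])
      show "inv' \<tau> ` ?X \<subseteq> ?X"
      proof
        fix z assume "z \<in> inv' \<tau> ` ?X"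
        then obtain y where y: "z = inv' \<tau> y" "y \<in> {1..n}" "block D y = block D x" by blast
        then have "z \<in> {1..n}" using permutes_interval_closed[OF y(2) \<tau>] by simp
        then show "z \<in> ?X" using bD[of z] y by (simp add: permutes_inverses[OF \<tau>])
      qed
      show "\<tau> ` ?X \<subseteq> ?X"
      proof
        fix z assume "z \<in> \<tau> ` ?X"
        then obtain y where y: "z = \<tau> y" "y \<in> {1..n}" "block D y = block D x" by blast
        then have "z \<in> {1..n}" using permutes_interval_closed[OF y(2) \<tau>] by simp
        then show "z \<in> ?X" using bD[of y] y by simp
      qed
    qed (simp_all add: permutes_inverses[OF \<tau>])
    then show ?thesis
    proof (rule monotone_rearrangement_unique[of ?X \<tau> "\<lambda>x. block C (v x)" "\<lambda>x. block C (w x)", rotated])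
      fix y z assume "y \<in> ?X" "z \<in> ?X" "y \<le> z"
      then show "block C (v y) \<le> block C (v z)" "block C (w y) \<le> block C (w z)"
        using mono[OF v, of y z] mono[OF w, of y z] by simp_all
    qed (use x bC in simp_all)
  qed
  have order: "v x < v y" if xy: "x \<in> {1..n}" "y \<in> {1..n}" and less: "w x < w y" for x y
  proof -
    have in_n: "w x \<in> {1..n}" "w y \<in> {1..n}" "v x \<in> {1..n}" "v y \<in> {1..n}"
      using xy permutes_interval_closed[OF _ vp] permutes_interval_closed[OF _ wp] by blast+
    show ?thesis
    proof (cases "block C (w x) = block C (w y)")
      case True
      have "inv' w (w x) < inv' w (w y)"
        using in_n less True by (intro increasing_on_blocks[OF C shortest_repsD(3)[OF w]]) simp_all
      then have "x < y" by (simp add: permutes_inverses[OF wp])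
      have "\<not> v y < v x"
      proof
        assume "v y < v x"
        moreover have "block C (v y) = block C (v x)" using True same xy by simp
        ultimately have "inv' v (v y) < inv' v (v x)"
          using in_n by (intro increasing_on_blocks[OF C shortest_repsD(3)[OF v]]) simp_all
        then show False using \<open>x < y\<close> by (simp add: permutes_inverses[OF vp])
      qed
      moreover have "v x \<noteq> v y" using \<open>x < y\<close> permutes_inj[OF vp] by (metis injD less_irrefl)
      ultimately show ?thesis by simp
    next
      case False
      have "block C (w x) \<le> block C (w y)" using less C by (simp add: block_mono)
      with False have "block C (v x) < block C (v y)" using same xy by simp
      then have "\<not> v y \<le> v x" using block_mono[OF C, of "v y" "v x"] by auto
      then show ?thesis by simp
    qed
  qed
  have "v \<circ> inv' w = id"
  proof (rule permutes_increasing_eq_id[OF permutes_compose[OF permutes_inv[OF wp] vp]])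
    fix i assume "1 \<le> i" "i < n"
    then have "inv' w i \<in> {1..n}" "inv' w (Suc i) \<in> {1..n}"
      using permutes_interval_closed(1)[OF _ wp] by simp_all
    from order[OF this] show "(v \<circ> inv' w) i < (v \<circ> inv' w) (Suc i)"
      by (simp add: permutes_inverses[OF wp])
  qed
  then have "v \<circ> (inv' w \<circ> w) = w" by (simp flip: comp_assoc)
  then show "v = w" by (simp add: permutes_inv_o[OF wp])
qed

text \<open>
  A permutation with the fewest inversions among those with the given table works: exchanging a
  descent that lies inside a block keeps the table and removes an inversion.
\<close>

lemma shortest_rep_exists:
  assumes C: "finite C" and D: "finite D" and w: "w permutes {1..n}"
  obtains v where "v \<in> shortest_reps n C D" "table n C v D = table n C w D"
proof -
  let ?P = "\<lambda>v. v permutes {1..n} \<and> table n C v D = table n C w D"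
  obtain v where v: "v permutes {1..n}" "table n C v D = table n C w D"
    and minimal: "\<And>u. u permutes {1..n} \<Longrightarrow> table n C u D = table n C w D \<Longrightarrow>
      card (inversions n v) \<le> card (inversions n u)"
    using ex_has_least_nat[of ?P w "\<lambda>v. card (inversions n v)"] w by blast
  have "v i < v (Suc i)" if i: "i \<in> {1..<n} - D" for i
  proof (rule ccontr)
    assume "\<not> v i < v (Suc i)"
    then have "v (Suc i) < v i" using permutes_Suc_neq[OF v(1), of i] by simp
    then have "card (inversions n (v \<circ> adj i)) < card (inversions n v)"
      using card_inversions_decrease[OF v(1), of i] i by simp
    moreover have "table n C (v \<circ> adj i) D = table n C w D"
      using table_young_comp[OF v(1) young_id adj_in_young[OF D i]] v(2) by simp
    moreover have "v \<circ> adj i permutes {1..n}"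
      using i by (intro permutes_compose[OF _ v(1)] adj_permutes) auto
    ultimately show False using minimal[of "v \<circ> adj i"] by simp
  qed
  moreover have "inv' v i < inv' v (Suc i)" if i: "i \<in> {1..<n} - C" for i
  proof (rule ccontr)
    note v' = permutes_inv[OF v(1)]
    assume "\<not> inv' v i < inv' v (Suc i)"
    then have "inv' v (Suc i) < inv' v i" using permutes_Suc_neq[OF v', of i] by simp
    then have "card (inversions n (inv' v \<circ> adj i)) < card (inversions n (inv' v))"
      using card_inversions_decrease[OF v', of i] i by simp
    moreover have sv: "adj i \<circ> v permutes {1..n}"
      using i by (intro permutes_compose[OF v(1)] adj_permutes) auto
    ultimately have "card (inversions n (adj i \<circ> v)) < card (inversions n v)"
      using card_inversions_inv[OF v(1)] card_inversions_inv[OF sv] unfolding inv_adj_comp[OF v(1)]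
      by simp
    moreover have "table n C (adj i \<circ> v) D = table n C w D"
      using table_young_comp[OF v(1) adj_in_young[OF C i] young_id] v(2) by simp
    ultimately show False using minimal[OF sv] by simp
  qed
  ultimately have "v \<in> shortest_reps n C D" using v(1) by (simp add: shortest_reps_def)
  then show thesis using v(2) that by blast
qed

section \<open>Every contingency table arises\<close>

text \<open>
  The block number of a cut is its rank among the cuts, so every rank below the number of cuts
  occurs.
\<close>

lemma block_less_card_surj:
  assumes C: "finite C" and k: "k < card C"
  obtains c where "c \<in> C" "block C c = k"
proof -
  have strict: "block C x < block C y" if "x \<in> C" "x < y" for x y
  proof -
    have "block C (Suc x) \<le> block C y" using that C by (intro block_mono) simp_all
    then show ?thesis using that C by (simp add: block_Suc)
  qed
  have "inj_on (block C) C"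
  proof (rule inj_onI)
    fix x y assume "x \<in> C" "y \<in> C" "block C x = block C y"
    then show "x = y" using strict[of x y] strict[of y x] by (cases x y rule: linorder_cases) simp_all
  qed
  then have "card (block C ` C) = card {..<card C}" by (simp add: card_image)
  moreover have "block C ` C \<subseteq> {..<card C}"
  proof
    fix b assume "b \<in> block C ` C"
    then obtain c where "c \<in> C" "b = block C c" by blast
    then show "b \<in> {..<card C}"
      using block_le_card[OF C, of "Suc c"] C by (simp add: block_Suc)
  qed
  ultimately have "block C ` C = {..<card C}" by (intro card_subset_eq) simp_all
  then have "k \<in> block C ` C" using k by simp
  then show thesis using that by blast
qed

lemma block_surj:
  assumes C: "C \<subseteq> {1..<n}" and "n \<ge> 1" and p: "p \<le> card C"
  shows "\<exists>x\<in>{1..n}. block C x = p"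
proof (cases p)
  case 0
  have none: "{c \<in> C. c < 1} = {}" using C by fastforce
  have "block C 1 = 0" unfolding block_def none by simp
  then show ?thesis using 0 \<open>n \<ge> 1\<close> by (intro bexI[of _ 1]) simp_all
next
  case (Suc k)
  have fin: "finite C" using C finite_subset by blast
  obtain c where c: "c \<in> C" "block C c = k" using block_less_card_surj[OF fin, of k] p Suc by auto
  then have "block C (Suc c) = p" using fin Suc by (simp add: block_Suc)
  then show ?thesis using c C by (intro bexI[of _ "Suc c"]) auto
qed

lemma card_Collect_interval: "card {x. Suc 0 \<le> x \<and> x \<le> n} = n"
proof -
  have "{x. Suc 0 \<le> x \<and> x \<le> n} = {1..n}" by auto
  then show ?thesis by simp
qed

lemma sum_card_fibres:
  assumes "finite A" "\<And>x. x \<in> A \<Longrightarrow> g x \<le> (m :: nat)"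
  shows "(\<Sum>q<Suc m. card {x \<in> A. P x \<and> g x = q}) = card {x \<in> A. P x}"
proof -
  have "(\<Sum>q<Suc m. \<Sum>x | x \<in> {x \<in> A. P x} \<and> g x = q. 1) = (\<Sum>x\<in>{x \<in> A. P x}. 1 :: nat)"
    by (rule sum.group) (use assms in \<open>auto simp: less_Suc_eq_le\<close>)
  then show ?thesis by (simp add: conj_assoc)
qed

lemma row_sum_table:
  assumes "finite C" "finite D" "p \<le> card C"
  shows "(\<Sum>q<Suc (card D). table n C w D $$ (p, q)) = card {x \<in> {1..n}. block C (w x) = p}"
proof -
  have "(\<Sum>q<Suc (card D). table n C w D $$ (p, q))
      = (\<Sum>q<Suc (card D). card {x \<in> {1..n}. block C (w x) = p \<and> block D x = q})"
    by (rule sum.cong) (use assms in \<open>simp_all add: index_table\<close>)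
  also have "\<dots> = card {x \<in> {1..n}. block C (w x) = p}"
    by (rule sum_card_fibres) (use assms block_le_card in auto)
  finally show ?thesis .
qed

lemma transpose_table:
  assumes w: "w permutes {1..n}"
  shows "transpose_mat (table n C w D) = table n D (inv' w) C"
proof (rule eq_matI)
  fix q p assume qp: "q < dim_row (table n D (inv' w) C)" "p < dim_col (table n D (inv' w) C)"
  have "bij_betw w {x \<in> {1..n}. block C (w x) = p \<and> block D x = q}
      {x \<in> {1..n}. block D (inv' w x) = q \<and> block C x = p}"
  proof (rule bij_betw_byWitness[where f' = "inv' w"])
    show "w ` {x \<in> {1..n}. block C (w x) = p \<and> block D x = q}
        \<subseteq> {x \<in> {1..n}. block D (inv' w x) = q \<and> block C x = p}"
    proof
      fix y assume "y \<in> w ` {x \<in> {1..n}. block C (w x) = p \<and> block D x = q}"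
      then obtain x where x: "y = w x" "x \<in> {1..n}" "block C (w x) = p" "block D x = q" by blast
      then show "y \<in> {x \<in> {1..n}. block D (inv' w x) = q \<and> block C x = p}"
        using permutes_interval_closed(2)[OF x(2) w] by (simp add: permutes_inverses[OF w])
    qed
    show "inv' w ` {x \<in> {1..n}. block D (inv' w x) = q \<and> block C x = p}
        \<subseteq> {x \<in> {1..n}. block C (w x) = p \<and> block D x = q}"
    proof
      fix y assume "y \<in> inv' w ` {x \<in> {1..n}. block D (inv' w x) = q \<and> block C x = p}"
      then obtain x where x: "y = inv' w x" "x \<in> {1..n}" "block D (inv' w x) = q" "block C x = p" by blast
      then show "y \<in> {x \<in> {1..n}. block C (w x) = p \<and> block D x = q}"
        using permutes_interval_closed(1)[OF x(2) w] by (simp add: permutes_inverses[OF w])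
    qed
  qed (simp_all add: permutes_inverses[OF w])
  then show "transpose_mat (table n C w D) $$ (q, p) = table n D (inv' w) C $$ (q, p)"
    using qp by (simp add: index_table less_Suc_eq_le bij_betw_same_card)
qed simp_all

lemma col_sum_table:
  assumes w: "w permutes {1..n}" and fin: "finite C" "finite D" and q: "q \<le> card D"
  shows "(\<Sum>p<Suc (card C). table n C w D $$ (p, q)) = card {x \<in> {1..n}. block D (inv' w x) = q}"
proof -
  have "(\<Sum>p<Suc (card C). table n C w D $$ (p, q))
      = (\<Sum>p<Suc (card C). table n D (inv' w) C $$ (q, p))"
    unfolding transpose_table[OF w, symmetric] by (rule sum.cong) (use q in simp_all)
  then show ?thesis using row_sum_table[OF fin(2,1) q] by simp
qed

lemma block_fibre_pos:
  assumes C: "C \<subseteq> {1..<n}" and "n \<ge> 1" and w: "w permutes {1..n}" and p: "p \<le> card C"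
  shows "card {x \<in> {1..n}. block C (w x) = p} > 0"
proof -
  obtain y where y: "y \<in> {1..n}" "block C y = p" using block_surj[OF C \<open>n \<ge> 1\<close> p] by blast
  then have "inv' w y \<in> {x \<in> {1..n}. block C (w x) = p}"
    using permutes_interval_closed(1)[OF y(1) w] by (simp add: permutes_inverses[OF w])
  then have "{x \<in> {1..n}. block C (w x) = p} \<noteq> {}" by blast
  then show ?thesis by (simp add: card_gt_0_iff)
qed

lemma table_in_contingency_tables:
  assumes C: "C \<subseteq> {1..<n}" and D: "D \<subseteq> {1..<n}" and n: "n \<ge> 1" and w: "w permutes {1..n}"
  shows "table n C w D \<in> contingency_tables n"
proof -
  have fin: "finite C" "finite D" using C D finite_subset by blast+
  have "(\<Sum>p<Suc (card C). \<Sum>q<Suc (card D). table n C w D $$ (p, q))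
      = (\<Sum>p<Suc (card C). card {x \<in> {1..n}. block C (w x) = p})"
    by (rule sum.cong) (simp_all only: row_sum_table[OF fin] lessThan_iff less_Suc_eq_le)
  also have "\<dots> = card {x \<in> {1..n}. True}"
    using sum_card_fibres[of "{1..n}" "\<lambda>x. block C (w x)" "card C" "\<lambda>_. True"] block_le_card[OF fin(1)] by simp
  also have "\<dots> = n" by (simp add: card_Collect_interval)
  finally have total: "(\<Sum>p<Suc (card C). \<Sum>q<Suc (card D). table n C w D $$ (p, q)) = n" .
  show ?thesis
    unfolding contingency_tables_def mem_Collect_eq dim_table
  proof (intro conjI allI impI)
    fix p assume "p < Suc (card C)"
    then show "0 < (\<Sum>q<Suc (card D). table n C w D $$ (p, q))"
      using row_sum_table[OF fin, of p] block_fibre_pos[OF C n w, of p] by simp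
  next
    fix q assume "q < Suc (card D)"
    then show "0 < (\<Sum>p<Suc (card C). table n C w D $$ (p, q))"
      using col_sum_table[OF w fin, of q] block_fibre_pos[OF D n permutes_inv[OF w], of q] by simp
  qed (use total in simp_all)
qed

lemma cuts_with_block_sizes:
  assumes "\<And>p. p \<le> k \<Longrightarrow> r p > 0" "(\<Sum>p<Suc k. r p) = n"
  shows "\<exists>C\<subseteq>{1..<n}. card C = k \<and> (\<forall>p\<le>k. card {x \<in> {1..n}. block C x = p} = r p)"
  using assms
proof (induction k arbitrary: n)
  case 0
  then show ?case by (intro exI[of _ "{}"]) (simp add: block_empty card_Collect_interval)
next
  case (Suc k)
  define m where "m = (\<Sum>p<Suc k. r p)"
  have n: "n = m + r (Suc k)" and r: "r (Suc k) > 0" using Suc.prems by (simp_all add: m_def)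
  have "m \<ge> 1" using Suc.prems(1)[of 0] by (simp add: m_def sum.lessThan_Suc_shift del: sum.lessThan_Suc)
  obtain C where C: "C \<subseteq> {1..<m}" "card C = k"
    and sizes: "\<And>p. p \<le> k \<Longrightarrow> card {x \<in> {1..m}. block C x = p} = r p"
    using Suc.IH[of m] Suc.prems(1) m_def by auto
  have fin: "finite C" using C finite_subset by blast
  have "m \<notin> C" using C by auto
  let ?C = "insert m C"
  have low: "block ?C x = block C x" if "x \<le> m" for x
    using that by (auto simp: block_def intro: arg_cong[where f = card])
  have high: "block ?C x = Suc k" if "m < x" for x
  proof -
    have "{c \<in> ?C. c < x} = ?C" using that C by auto
    then show ?thesis using fin \<open>m \<notin> C\<close> C by (simp add: block_def)
  qed
  have "card {x \<in> {1..n}. block ?C x = p} = r p" if "p \<le> Suc k" for p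
  proof (cases "p = Suc k")
    case True
    have "{x \<in> {1..n}. block ?C x = p} = {m + 1..n}"
    proof (intro equalityI subsetI)
      fix x assume x: "x \<in> {x \<in> {1..n}. block ?C x = p}"
      have "\<not> x \<le> m" using x low[of x] block_le_card[OF fin, of x] True C by auto
      then show "x \<in> {m + 1..n}" using x by auto
    qed (use high True in auto)
    then show ?thesis using n True by simp
  next
    case False
    have "{x \<in> {1..n}. block ?C x = p} = {x \<in> {1..m}. block C x = p}"
    proof (intro equalityI subsetI)
      fix x assume x: "x \<in> {x \<in> {1..n}. block ?C x = p}"
      then have "x \<le> m" using high[of x] False by (cases "x \<le> m") auto
      then show "x \<in> {x \<in> {1..m}. block C x = p}" using x low by simp
    qed (use low n in auto)
    then show ?thesis using sizes[of p] that False by simp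
  qed
  moreover have "?C \<subseteq> {1..<n}" using C n r \<open>m \<ge> 1\<close> by auto
  moreover have "card ?C = Suc k" using fin \<open>m \<notin> C\<close> C by simp
  ultimately show ?case by (intro exI[of _ ?C]) simp
qed

text \<open>
  Every entry of the matrix supplies that many tokens, labelled by the row and the column of the
  entry; numbering all tokens from 1 to \<open>n\<close> and reading off the labels gives the two functions.
\<close>

lemma functions_with_joint_counts:
  fixes A :: "nat mat"
  assumes total: "(\<Sum>i<dim_row A. \<Sum>j<dim_col A. A $$ (i, j)) = n"
  obtains f g where "\<And>x. x \<in> {1..n} \<Longrightarrow> f x < dim_row A" "\<And>x. x \<in> {1..n} \<Longrightarrow> g x < dim_col A"
    "\<And>i j. i < dim_row A \<Longrightarrow> j < dim_col A \<Longrightarrow> card {x \<in> {1..n}. f x = i \<and> g x = j} = A $$ (i, j)"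
proof -
  define X where "X = (SIGMA ij:{..<dim_row A} \<times> {..<dim_col A}. {..<A $$ ij})"
  have "finite X" unfolding X_def by (intro finite_SigmaI) simp_all
  have "card X = (\<Sum>ij\<in>{..<dim_row A} \<times> {..<dim_col A}. A $$ ij)"
    unfolding X_def by (subst card_SigmaI) simp_all
  also have "\<dots> = card {1..n}" using total by (simp add: sum.cartesian_product)
  finally obtain h where h: "bij_betw h {1..n} X"
    using finite_same_card_bij[OF finite_atLeastAtMost \<open>finite X\<close>] by metis
  have hX: "h x \<in> X" if "x \<in> {1..n}" for x using h that by (rule bij_betwE[THEN bspec])
  show thesis
  proof (rule that[of "\<lambda>x. fst (fst (h x))" "\<lambda>x. snd (fst (h x))"])
    fix i j assume ij: "i < dim_row A" "j < dim_col A"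
    have "bij_betw h {x \<in> {1..n}. fst (fst (h x)) = i \<and> snd (fst (h x)) = j} ({(i, j)} \<times> {..<A $$ (i, j)})"
    proof (rule bij_betw_imageI)
      show "inj_on h {x \<in> {1..n}. fst (fst (h x)) = i \<and> snd (fst (h x)) = j}"
        using bij_betw_imp_inj_on[OF h] by (rule inj_on_subset) blast
      show "h ` {x \<in> {1..n}. fst (fst (h x)) = i \<and> snd (fst (h x)) = j} = {(i, j)} \<times> {..<A $$ (i, j)}"
      proof (intro equalityI subsetI)
        fix z assume "z \<in> h ` {x \<in> {1..n}. fst (fst (h x)) = i \<and> snd (fst (h x)) = j}"
        then obtain x where "z = h x" "x \<in> {1..n}" "fst (fst (h x)) = i" "snd (fst (h x)) = j" by blast
        then show "z \<in> {(i, j)} \<times> {..<A $$ (i, j)}" using hX[of x] by (auto simp: X_def)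
      next
        fix z assume z: "z \<in> {(i, j)} \<times> {..<A $$ (i, j)}"
        then have "z \<in> X" using ij by (auto simp: X_def)
        then obtain x where "x \<in> {1..n}" "z = h x" using bij_betw_imp_surj_on[OF h] by blast
        then show "z \<in> h ` {x \<in> {1..n}. fst (fst (h x)) = i \<and> snd (fst (h x)) = j}" using z by auto
      qed
    qed
    then show "card {x \<in> {1..n}. fst (fst (h x)) = i \<and> snd (fst (h x)) = j} = A $$ (i, j)"
      by (simp add: bij_betw_same_card)
  next
    fix x assume "x \<in> {1..n}"
    from hX[OF this] show "fst (fst (h x)) < dim_row A" "snd (fst (h x)) < dim_col A"
      by (auto simp: X_def)
  qed
qed

lemma permutation_to_blocks:
  assumes f: "\<And>x. x \<in> {1..n} \<Longrightarrow> f x \<le> k" and pos: "\<And>p. p \<le> k \<Longrightarrow> card {x \<in> {1..n}. f x = p} > 0"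
  obtains C \<sigma> where "C \<subseteq> {1..<n}" "card C = k" "\<sigma> permutes {1..n}"
    "\<And>x. x \<in> {1..n} \<Longrightarrow> f x = block C (\<sigma> x)"
proof -
  have "(\<Sum>p<Suc k. card {x \<in> {1..n}. f x = p}) = n"
    using sum_card_fibres[of "{1..n}" f k "\<lambda>_. True"] f by (simp add: card_Collect_interval)
  from cuts_with_block_sizes[of k "\<lambda>p. card {x \<in> {1..n}. f x = p}", OF pos this]
  obtain C where C: "C \<subseteq> {1..<n}" "card C = k"
    and sizes: "\<And>p. p \<le> k \<Longrightarrow> card {x \<in> {1..n}. block C x = p} = card {x \<in> {1..n}. f x = p}"
    by blast
  have fin: "finite C" using C finite_subset by blast
  have cards: "card {x \<in> {1..n}. f x = p} = card {x \<in> {1..n}. block C x = p}" for p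
  proof (cases "p \<le> k")
    case False
    have "{x \<in> {1..n}. f x = p} = {}" using False f by auto
    moreover have "{x \<in> {1..n}. block C x = p} = {}" using False block_le_card[OF fin] C by auto
    ultimately show ?thesis by (simp only:)
  next
    case True
    then show ?thesis by (rule sizes[symmetric])
  qed
  obtain \<sigma> where "\<sigma> permutes {1..n}" "\<forall>x\<in>{1..n}. f x = block C (\<sigma> x)"
    using equal_fibre_cards_imp_permutation[OF finite_atLeastAtMost cards] by blast
  then show thesis using that C by blast
qed

text \<open>
  Number the units that the entries count. Their row labels are, up to a permutation \<open>\<sigma>\<close>, the
  block numbers for the cuts at the partial row sums, and their column labels are similarly block
  numbers up to a permutation \<open>\<tau>\<close>. The permutation sought sends the position that \<open>\<tau>\<close> gives to a
  unit to the value that \<open>\<sigma>\<close> gives to it. Positivity of the sums makes the partial sums distinct.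
\<close>

lemma contingency_table_is_table:
  assumes A: "A \<in> contingency_tables n"
  obtains C D w where "C \<subseteq> {1..<n}" "D \<subseteq> {1..<n}" "w permutes {1..n}" "A = table n C w D"
proof -
  obtain k l where kl: "dim_row A = Suc k" "dim_col A = Suc l"
    using A unfolding contingency_tables_def by (metis (mono_tags, lifting) Suc_le_D One_nat_def mem_Collect_eq)
  have rows: "\<And>i. i \<le> k \<Longrightarrow> (\<Sum>j<Suc l. A $$ (i, j)) > 0"
    and cols: "\<And>j. j \<le> l \<Longrightarrow> (\<Sum>i<Suc k. A $$ (i, j)) > 0"
    and total: "(\<Sum>i<dim_row A. \<Sum>j<dim_col A. A $$ (i, j)) = n"
    using A unfolding contingency_tables_def mem_Collect_eq kl less_Suc_eq_le by blast+
  obtain f g where f: "\<And>x. x \<in> {1..n} \<Longrightarrow> f x \<le> k" and g: "\<And>x. x \<in> {1..n} \<Longrightarrow> g x \<le> l"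
    and joint: "\<And>i j. i \<le> k \<Longrightarrow> j \<le> l \<Longrightarrow> card {x \<in> {1..n}. f x = i \<and> g x = j} = A $$ (i, j)"
    using functions_with_joint_counts[OF total] unfolding kl less_Suc_eq_le by blast
  have fpos: "card {x \<in> {1..n}. f x = i} > 0" if "i \<le> k" for i
  proof -
    have "card {x \<in> {1..n}. f x = i} = (\<Sum>j<Suc l. card {x \<in> {1..n}. f x = i \<and> g x = j})"
      by (rule sum_card_fibres[symmetric]) (use g in simp_all)
    also have "\<dots> = (\<Sum>j<Suc l. A $$ (i, j))" by (rule sum.cong) (use joint that in simp_all)
    finally show ?thesis using rows[OF that] by simp
  qed
  obtain C \<sigma> where C: "C \<subseteq> {1..<n}" "card C = k" and \<sigma>: "\<sigma> permutes {1..n}"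
    and f\<sigma>: "\<And>x. x \<in> {1..n} \<Longrightarrow> f x = block C (\<sigma> x)"
    using permutation_to_blocks[OF f fpos] by blast
  have gpos: "card {x \<in> {1..n}. g x = j} > 0" if "j \<le> l" for j
  proof -
    have "card {x \<in> {1..n}. g x = j} = (\<Sum>i<Suc k. card {x \<in> {1..n}. g x = j \<and> f x = i})"
      by (rule sum_card_fibres[symmetric]) (use f in simp_all)
    also have "\<dots> = (\<Sum>i<Suc k. A $$ (i, j))"
    proof (rule sum.cong[OF refl])
      fix i assume "i \<in> {..<Suc k}"
      then show "card {x \<in> {1..n}. g x = j \<and> f x = i} = A $$ (i, j)"
        using joint[of i j] that by (simp add: conj_commute)
    qed
    finally show ?thesis using cols[OF that] by simp
  qed
  obtain D \<tau> where D: "D \<subseteq> {1..<n}" "card D = l" and \<tau>: "\<tau> permutes {1..n}"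
    and g\<tau>: "\<And>x. x \<in> {1..n} \<Longrightarrow> g x = block D (\<tau> x)"
    using permutation_to_blocks[OF g gpos] by blast
  let ?w = "\<sigma> \<circ> inv' \<tau>"
  have w: "?w permutes {1..n}" using permutes_compose[OF permutes_inv[OF \<tau>] \<sigma>] .
  have "A = table n C ?w D"
  proof (rule eq_matI)
    fix i j assume "i < dim_row (table n C ?w D)" "j < dim_col (table n C ?w D)"
    then have ij: "i \<le> k" "j \<le> l" using C D by simp_all
    have "bij_betw (inv' \<tau>) {x \<in> {1..n}. block C (?w x) = i \<and> block D x = j}
        {x \<in> {1..n}. f x = i \<and> g x = j}"
    proof (rule bij_betw_byWitness[where f' = \<tau>])
      show "inv' \<tau> ` {x \<in> {1..n}. block C (?w x) = i \<and> block D x = j} \<subseteq> {x \<in> {1..n}. f x = i \<and> g x = j}"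
      proof
        fix y assume "y \<in> inv' \<tau> ` {x \<in> {1..n}. block C (?w x) = i \<and> block D x = j}"
        then obtain x where x: "y = inv' \<tau> x" "x \<in> {1..n}" "block C (?w x) = i" "block D x = j" by blast
        have "y \<in> {1..n}" using permutes_interval_closed(1)[OF x(2) \<tau>] x(1) by simp
        then show "y \<in> {x \<in> {1..n}. f x = i \<and> g x = j}"
          using x f\<sigma> g\<tau> by (simp add: permutes_inverses[OF \<tau>])
      qed
      show "\<tau> ` {x \<in> {1..n}. f x = i \<and> g x = j} \<subseteq> {x \<in> {1..n}. block C (?w x) = i \<and> block D x = j}"
      proof
        fix y assume "y \<in> \<tau> ` {x \<in> {1..n}. f x = i \<and> g x = j}"
        then obtain x where x: "y = \<tau> x" "x \<in> {1..n}" "f x = i" "g x = j" by blast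
        have "y \<in> {1..n}" using permutes_interval_closed(2)[OF x(2) \<tau>] x(1) by simp
        then show "y \<in> {x \<in> {1..n}. block C (?w x) = i \<and> block D x = j}"
          using x f\<sigma>[OF x(2)] g\<tau>[OF x(2)] by (simp add: permutes_inverses[OF \<tau>])
      qed
    qed (simp_all add: permutes_inverses[OF \<tau>])
    then show "A $$ (i, j) = table n C ?w D $$ (i, j)"
      using ij joint[OF ij] C D by (simp only: index_table bij_betw_same_card)
  qed (use kl C D in simp_all)
  then show thesis using that C D w by blast
qed

section \<open>Refinement is deletion of cuts\<close>

lemma block_delete_cut:
  assumes C: "finite C" and c: "c \<in> C"
  shows "block (C - {c}) x = (if block C x \<le> block C c then block C x else block C x - 1)"
proof (cases "x \<le> c")
  case True
  then have "{d \<in> C - {c}. d < x} = {d \<in> C. d < x}" by auto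
  then show ?thesis using block_mono[OF C True] by (simp add: block_def)
next
  case False
  then have "block C (Suc c) \<le> block C x" using C by (intro block_mono) simp_all
  then have "block C c < block C x" using C c by (simp add: block_Suc)
  moreover have "{d \<in> C - {c}. d < x} = {d \<in> C. d < x} - {c}" by auto
  then have "block (C - {c}) x = block C x - 1" using False C c by (simp add: block_def)
  ultimately show ?thesis by simp
qed

text \<open>
  Deleting a cut unites the block that ends with it and the next block, and lowers the numbers of
  all blocks behind these by one.
\<close>

lemma merge_rows_table:
  assumes C: "finite C" and c: "c \<in> C"
  shows "merge_rows (block C c) (table n C w D) = table n (C - {c}) w D"
proof (rule eq_matI)
  let ?k = "block C c"
  have pos: "card C > 0" using C c by (auto simp: card_gt_0_iff)
  have k: "?k < card C" using block_le_card[OF C, of "Suc c"] C c by (simp add: block_Suc)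
  fix p q assume pq: "p < dim_row (table n (C - {c}) w D)" "q < dim_col (table n (C - {c}) w D)"
  have p: "p < card C" and q: "q \<le> card D" using pq C c pos by simp_all
  let ?F = "\<lambda>p. {x \<in> {1..n}. block C (w x) = p \<and> block D x = q}"
  have new: "table n (C - {c}) w D $$ (p, q) = card {x \<in> {1..n}. block (C - {c}) (w x) = p \<and> block D x = q}"
    using pq by (simp add: index_table less_Suc_eq_le)
  have old: "table n C w D $$ (p', q) = card (?F p')" if "p' \<le> card C" for p'
    using that q by (simp add: index_table)
  have merged: "merge_rows ?k (table n C w D) $$ (p, q) = (if p < ?k then card (?F p)
      else if p = ?k then card (?F ?k) + card (?F (Suc ?k)) else card (?F (Suc p)))"
    using p q k by (simp add: merge_rows_def old)
  consider "p < ?k" | "p = ?k" | "p > ?k" by linarith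
  then show "merge_rows ?k (table n C w D) $$ (p, q) = table n (C - {c}) w D $$ (p, q)"
  proof cases
    case 1
    have "{x \<in> {1..n}. block (C - {c}) (w x) = p \<and> block D x = q} = ?F p"
      using 1 by (intro Collect_cong) (auto simp: block_delete_cut[OF C c])
    then show ?thesis using 1 merged new by simp
  next
    case 2
    have "{x \<in> {1..n}. block (C - {c}) (w x) = p \<and> block D x = q} = ?F ?k \<union> ?F (Suc ?k)"
      using 2 by (auto simp: block_delete_cut[OF C c] split: if_splits)
    moreover have "card (?F ?k \<union> ?F (Suc ?k)) = card (?F ?k) + card (?F (Suc ?k))"
      by (rule card_Un_disjoint) auto
    ultimately show ?thesis using 2 merged new by simp
  next
    case 3
    have "{x \<in> {1..n}. block (C - {c}) (w x) = p \<and> block D x = q} = ?F (Suc p)"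
      using 3 by (intro Collect_cong) (auto simp: block_delete_cut[OF C c])
    then show ?thesis using 3 merged new by simp
  qed
qed (use card_Suc_Diff1[OF C c] in \<open>simp_all add: merge_rows_def del: card_Diff_insert card_Diff_singleton\<close>)

lemma merge_cols_eq_transpose:
  assumes "k + 1 < dim_col A"
  shows "merge_cols k A = transpose_mat (merge_rows k (transpose_mat A))"
  by (rule eq_matI) (use assms in \<open>auto simp: merge_cols_def merge_rows_def\<close>)

text \<open>
  Transposing a table replaces the permutation by its inverse and exchanges the two sets of cuts, so
  this reduces to the merging of rows.
\<close>

lemma merge_cols_table:
  assumes w: "w permutes {1..n}" and D: "finite D" and d: "d \<in> D"
  shows "merge_cols (block D d) (table n C w D) = table n C w (D - {d})"
proof -
  have "block D d + 1 < dim_col (table n C w D)"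
    using block_le_card[OF D, of "Suc d"] D d by (simp add: block_Suc)
  then have "merge_cols (block D d) (table n C w D)
      = transpose_mat (merge_rows (block D d) (transpose_mat (table n C w D)))"
    by (rule merge_cols_eq_transpose)
  also have "\<dots> = transpose_mat (transpose_mat (table n C w (D - {d})))"
    by (simp only: transpose_table[OF w] merge_rows_table[OF D d])
  finally show ?thesis by simp
qed

text \<open>
  The \<open>k\<close>-th merge of adjacent rows is the deletion of the cut of rank \<open>k\<close>, and likewise for columns.
  Hence chains of covers below a table are successive deletions of cuts, with the permutation kept.
\<close>

lemma refinement_le_table_iff:
  assumes C: "C \<subseteq> {1..<n}" and D: "D \<subseteq> {1..<n}" and n: "n \<ge> 1" and w: "w permutes {1..n}"
  shows "refinement_le n A (table n C w D) \<longleftrightarrow> (\<exists>C'\<subseteq>C. \<exists>D'\<subseteq>D. A = table n C' w D')"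
proof
  assume "refinement_le n A (table n C w D)"
  then have "(refinement_cover n)\<^sup>*\<^sup>* A (table n C w D)" by (simp add: refinement_le_def)
  then show "\<exists>C'\<subseteq>C. \<exists>D'\<subseteq>D. A = table n C' w D'"
  proof (induction rule: converse_rtranclp_induct)
    case base
    then show ?case by blast
  next
    case (step A B)
    then obtain C' D' where sub: "C' \<subseteq> C" "D' \<subseteq> D" and B: "B = table n C' w D'" by blast
    have fin: "finite C'" "finite D'" using sub C D by (meson finite_subset finite_atLeastLessThan)+
    from step.hyps(1) B consider
        k where "k < card C'" "A = merge_rows k (table n C' w D')"
      | k where "k < card D'" "A = merge_cols k (table n C' w D')"
      by (auto simp: refinement_cover_def)
    then show ?case
    proof cases
      case 1
      then obtain c where "c \<in> C'" "block C' c = k" using block_less_card_surj[OF fin(1)] by metis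
      then have "A = table n (C' - {c}) w D'" using 1 merge_rows_table[OF fin(1)] by blast
      moreover have "C' - {c} \<subseteq> C" using sub by blast
      ultimately show ?thesis using sub(2) by (intro exI conjI)
    next
      case 2
      then obtain d where "d \<in> D'" "block D' d = k" using block_less_card_surj[OF fin(2)] by metis
      then have "A = table n C' w (D' - {d})" using 2 merge_cols_table[OF w fin(2)] by blast
      moreover have "D' - {d} \<subseteq> D" using sub by blast
      ultimately show ?thesis using sub(1) by (intro exI conjI)
    qed
  qed
next
  have fin: "finite C" "finite D" using C D finite_subset by blast+
  have "refinement_le n (table n C' w D') (table n C w D)"
    if "C' \<subseteq> C" "D' \<subseteq> D" for C' D'
    using fin C D that
  proof (induction "card (C - C') + card (D - D')" arbitrary: C D rule: less_induct)
    case less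
    consider "C = C'" "D = D'" | c where "c \<in> C - C'" | d where "d \<in> D - D'"
      using less.prems by blast
    then show ?case
    proof cases
      case 1
      then show ?thesis by (simp add: refinement_le_def)
    next
      case 2
      then have "C - {c} - C' \<subset> C - C'" by blast
      then have "card (C - {c} - C') < card (C - C')" using less.prems(1) by (intro psubset_card_mono) auto
      then have "refinement_le n (table n C' w D') (table n (C - {c}) w D)"
        using less.prems 2 by (intro less.hyps) auto
      moreover have "refinement_cover n (table n (C - {c}) w D) (table n C w D)"
        unfolding refinement_cover_def
      proof (intro conjI disjI1 exI[of _ "block C c"])
        show "block C c + 1 < dim_row (table n C w D)"
          using block_le_card[of C "Suc c"] less.prems 2 by (simp add: block_Suc)
        show "table n (C - {c}) w D = merge_rows (block C c) (table n C w D)"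
          using merge_rows_table[of C c] less.prems 2 by simp
      qed (use less.prems n w in \<open>intro table_in_contingency_tables; blast\<close>)+
      ultimately show ?thesis by (simp add: refinement_le_def)
    next
      case 3
      then have "D - {d} - D' \<subset> D - D'" by blast
      then have "card (D - {d} - D') < card (D - D')" using less.prems(2) by (intro psubset_card_mono) auto
      then have "refinement_le n (table n C' w D') (table n C w (D - {d}))"
        using less.prems 3 by (intro less.hyps) auto
      moreover have "refinement_cover n (table n C w (D - {d})) (table n C w D)"
        unfolding refinement_cover_def
      proof (intro conjI disjI2 exI[of _ "block D d"])
        show "block D d + 1 < dim_col (table n C w D)"
          using block_le_card[of D "Suc d"] less.prems 3 by (simp add: block_Suc)
        show "table n C w (D - {d}) = merge_cols (block D d) (table n C w D)"
          using merge_cols_table[OF w, of D d] less.prems 3 by simp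
      qed (use less.prems n w in \<open>intro table_in_contingency_tables; blast\<close>)+
      ultimately show ?thesis by (simp add: refinement_le_def)
    qed
  qed
  moreover assume "\<exists>C'\<subseteq>C. \<exists>D'\<subseteq>D. A = table n C' w D'"
  ultimately show "refinement_le n A (table n C w D)" by blast
qed

section \<open>The isomorphism\<close>

definition cuts :: "nat \<Rightarrow> (nat \<Rightarrow> nat) set \<Rightarrow> nat set" where
  "cuts n I = {i \<in> {1..<n}. adj i \<notin> I}"

definition table_of :: "nat \<Rightarrow> (nat \<Rightarrow> nat) set \<times> (nat \<Rightarrow> nat) \<times> (nat \<Rightarrow> nat) set \<Rightarrow> nat mat" where
  "table_of n = (\<lambda>(I, w, J). table n (cuts n I) w (cuts n J))"

lemma cuts_subset: "cuts n I \<subseteq> {1..<n}"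
  by (auto simp: cuts_def)

lemma finite_cuts: "finite (cuts n I)"
  using cuts_subset finite_subset by blast

lemma adj_image_cuts:
  assumes "I \<subseteq> adjacent_transpositions n"
  shows "adj ` ({1..<n} - cuts n I) = I"
proof -
  have "{1..<n} - cuts n I = {i \<in> {1..<n}. adj i \<in> I}" by (auto simp: cuts_def)
  moreover have "I \<subseteq> adj ` {1..<n}" using assms by (simp add: adjacent_transpositions_def)
  ultimately show ?thesis by blast
qed

lemma cuts_adj_image:
  assumes "C \<subseteq> {1..<n}"
  shows "cuts n (adj ` ({1..<n} - C)) = C"
proof -
  have "adj i \<in> adj ` ({1..<n} - C) \<longleftrightarrow> i \<in> {1..<n} - C" for i
    by (rule inj_image_mem_iff[OF inj_adj])
  then show ?thesis using assms by (auto simp: cuts_def)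
qed

lemma cuts_antimono_iff:
  assumes "I \<subseteq> adjacent_transpositions n" "I' \<subseteq> adjacent_transpositions n"
  shows "cuts n I \<subseteq> cuts n I' \<longleftrightarrow> I' \<subseteq> I"
proof
  assume "cuts n I \<subseteq> cuts n I'"
  then have "adj ` ({1..<n} - cuts n I') \<subseteq> adj ` ({1..<n} - cuts n I)" by blast
  then show "I' \<subseteq> I" using assms by (simp only: adj_image_cuts)
qed (auto simp: cuts_def)

lemma double_coset_reps_sym_group:
  "double_coset_reps (sym_group n) (adjacent_transpositions n)
     (adj ` ({1..<n} - C)) (adj ` ({1..<n} - D)) = shortest_reps n C D"
proof (rule Set.set_eqI)
  fix w
  have sub: "adj ` ({1..<n} - B) \<subseteq> adj ` {i \<in> {1..<n}. P i} \<longleftrightarrow> (\<forall>i\<in>{1..<n} - B. P i)" for B P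
    unfolding inj_image_subset_iff[OF inj_adj] by blast
  show "w \<in> double_coset_reps (sym_group n) (adjacent_transpositions n)
      (adj ` ({1..<n} - C)) (adj ` ({1..<n} - D)) \<longleftrightarrow> w \<in> shortest_reps n C D"
  proof (cases "w permutes {1..n}")
    case True
    show ?thesis
      unfolding double_coset_reps_def shortest_reps_def mem_Collect_eq sym_group_carrier
        left_ascents_sym_group[OF True] right_ascents_sym_group[OF True] sub by blast
  next
    case False
    then show ?thesis
      unfolding double_coset_reps_def shortest_reps_def mem_Collect_eq sym_group_carrier by blast
  qed
qed

lemma two_sided_coxeter_complex_sym_group_iff:
  "(I, w, J) \<in> two_sided_coxeter_complex (sym_group n) (adjacent_transpositions n) \<longleftrightarrow>
    I \<subseteq> adjacent_transpositions n \<and> J \<subseteq> adjacent_transpositions n \<and>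
    w \<in> shortest_reps n (cuts n I) (cuts n J)"
proof -
  have "double_coset_reps (sym_group n) (adjacent_transpositions n) I J
      = shortest_reps n (cuts n I) (cuts n J)"
    if "I \<subseteq> adjacent_transpositions n" "J \<subseteq> adjacent_transpositions n"
    using double_coset_reps_sym_group[of n "cuts n I" "cuts n J"] that by (simp only: adj_image_cuts)
  then show ?thesis unfolding two_sided_coxeter_complex_def by auto
qed

lemma double_coset_sym_group:
  assumes "I \<subseteq> adjacent_transpositions n" "J \<subseteq> adjacent_transpositions n" "w permutes {1..n}"
  shows "parabolic_double_coset (sym_group n) I w J =
    {v. v permutes {1..n} \<and> table_of n (I, v, J) = table_of n (I, w, J)}"
  using double_coset_eq_same_table[OF assms(3) finite_cuts[of n I] finite_cuts[of n J]] assms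
  by (simp only: adj_image_cuts table_of_def prod.case)

text \<open>
  Fewer cuts mean larger Young subgroups, so permutations in the same double coset for the fine cuts
  lie in the same double coset for the coarse ones.
\<close>

lemma coarser_table_eq:
  assumes "C \<subseteq> C'" "D \<subseteq> D'" and fin: "finite C'" "finite D'"
    and v: "v permutes {1..n}" and w: "w permutes {1..n}"
    and eq: "table n C' v D' = table n C' w D'"
  shows "table n C v D = table n C w D"
proof -
  obtain u u' where u: "u \<in> young n C'" "u' \<in> young n D'" and vw: "v = u \<circ> w \<circ> u'"
    using same_table_imp_young_factors[OF w v fin eq] .
  have coarsen: "p \<in> young n A" if "A \<subseteq> B" "finite B" "p \<in> young n B" for A B p
  proof -
    have "generate (sym_group n) (adj ` ({1..<n} - B)) \<subseteq> generate (sym_group n) (adj ` ({1..<n} - A))"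
      by (rule group.mono_generate[OF sym_group_is_group]) (use that in blast)
    then show ?thesis using that generate_adj_eq_young finite_subset by blast
  qed
  show ?thesis
    unfolding vw using table_young_comp[OF w] coarsen assms(1,2) fin u by blast
qed

text \<open>
  Both relations say that the cuts of \<open>x\<close> are among those of \<open>y\<close> and that the permutation of \<open>y\<close> has the
  table of \<open>x\<close> with respect to the cuts of \<open>x\<close>. For the Coxeter complex, a double coset for finer cuts is
  contained in one for coarser cuts as soon as its representative is. For tables, refinement
  deletes cuts but does not say which; that the remaining ones are the cuts of \<open>x\<close> holds because a
  table determines its cuts.
\<close>

lemma coxeter_le_iff_refinement_le:
  assumes n: "n \<ge> 1"
    and x: "x \<in> two_sided_coxeter_complex (sym_group n) (adjacent_transpositions n)"
    and y: "y \<in> two_sided_coxeter_complex (sym_group n) (adjacent_transpositions n)"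
  shows "two_sided_coxeter_le (sym_group n) x y \<longleftrightarrow> refinement_le n (table_of n x) (table_of n y)"
proof -
  obtain I w J where x_eq: "x = (I, w, J)" by (cases x) auto
  obtain I' w' J' where y_eq: "y = (I', w', J')" by (cases y) auto
  have I: "I \<subseteq> adjacent_transpositions n" "J \<subseteq> adjacent_transpositions n"
    and w: "w permutes {1..n}"
    using x unfolding x_eq two_sided_coxeter_complex_sym_group_iff by (blast dest: shortest_repsD(1))+
  have I': "I' \<subseteq> adjacent_transpositions n" "J' \<subseteq> adjacent_transpositions n"
    and w': "w' permutes {1..n}"
    using y unfolding y_eq two_sided_coxeter_complex_sym_group_iff by (blast dest: shortest_repsD(1))+
  have "parabolic_double_coset (sym_group n) I' w' J' \<subseteq> parabolic_double_coset (sym_group n) I w J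
      \<longleftrightarrow> table_of n (I, w', J) = table_of n (I, w, J)"
    if sub: "cuts n I \<subseteq> cuts n I'" "cuts n J \<subseteq> cuts n J'"
  proof
    assume "parabolic_double_coset (sym_group n) I' w' J' \<subseteq> parabolic_double_coset (sym_group n) I w J"
    then show "table_of n (I, w', J) = table_of n (I, w, J)"
      unfolding double_coset_sym_group[OF I w] double_coset_sym_group[OF I' w'] using w' by blast
  next
    assume eq: "table_of n (I, w', J) = table_of n (I, w, J)"
    show "parabolic_double_coset (sym_group n) I' w' J' \<subseteq> parabolic_double_coset (sym_group n) I w J"
      unfolding double_coset_sym_group[OF I w] double_coset_sym_group[OF I' w']
    proof (rule Collect_mono, rule impI)
      fix v assume "v permutes {1..n} \<and> table_of n (I', v, J') = table_of n (I', w', J')"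
      then have v: "v permutes {1..n}"
        and "table n (cuts n I') v (cuts n J') = table n (cuts n I') w' (cuts n J')"
        by (simp_all add: table_of_def)
      then have "table n (cuts n I) v (cuts n J) = table n (cuts n I) w' (cuts n J)"
        using coarser_table_eq[OF sub finite_cuts finite_cuts v w'] by blast
      then show "v permutes {1..n} \<and> table_of n (I, v, J) = table_of n (I, w, J)"
        using v eq by (simp add: table_of_def)
    qed
  qed
  then have "two_sided_coxeter_le (sym_group n) x y \<longleftrightarrow>
      cuts n I \<subseteq> cuts n I' \<and> cuts n J \<subseteq> cuts n J' \<and>
      table n (cuts n I) w (cuts n J) = table n (cuts n I) w' (cuts n J)"
    unfolding x_eq y_eq two_sided_coxeter_le_def prod.case
      cuts_antimono_iff[OF I(1) I'(1), symmetric] cuts_antimono_iff[OF I(2) I'(2), symmetric]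
    by (auto simp: table_of_def)
  also have "\<dots> \<longleftrightarrow> (\<exists>C\<subseteq>cuts n I'. \<exists>D\<subseteq>cuts n J'. table n (cuts n I) w (cuts n J) = table n C w' D)"
  proof
    assume "\<exists>C\<subseteq>cuts n I'. \<exists>D\<subseteq>cuts n J'. table n (cuts n I) w (cuts n J) = table n C w' D"
    then obtain C D where sub: "C \<subseteq> cuts n I'" "D \<subseteq> cuts n J'"
      and eq: "table n (cuts n I) w (cuts n J) = table n C w' D" by blast
    have "C \<subseteq> {1..<n}" "D \<subseteq> {1..<n}" using sub cuts_subset by blast+
    then have "cuts n I = C" "cuts n J = D"
      using table_determines_cuts[OF cuts_subset _ cuts_subset _ w w' eq] by blast+
    then show "cuts n I \<subseteq> cuts n I' \<and> cuts n J \<subseteq> cuts n J' \<and>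
      table n (cuts n I) w (cuts n J) = table n (cuts n I) w' (cuts n J)"
      using sub eq by simp
  qed blast
  also have "\<dots> \<longleftrightarrow> refinement_le n (table_of n x) (table_of n y)"
    unfolding x_eq y_eq table_of_def prod.case
    by (rule refinement_le_table_iff[OF cuts_subset cuts_subset n w', symmetric])
  finally show ?thesis .
qed

text \<open>
  A table determines the cuts, hence \<open>I\<close> and \<open>J\<close>, and then the representative of its double coset.
\<close>

lemma bij_betw_table_of:
  assumes n: "n \<ge> 1"
  shows "bij_betw (table_of n)
    (two_sided_coxeter_complex (sym_group n) (adjacent_transpositions n)) (contingency_tables n)"
    (is "bij_betw _ ?X _")
proof (rule bij_betw_imageI)
  show "inj_on (table_of n) ?X"
  proof (rule inj_onI)
    fix x y assume x: "x \<in> ?X" and y: "y \<in> ?X" and eq: "table_of n x = table_of n y"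
    obtain I w J where x_eq: "x = (I, w, J)" by (cases x) auto
    obtain I' w' J' where y_eq: "y = (I', w', J')" by (cases y) auto
    have I: "I \<subseteq> adjacent_transpositions n" "J \<subseteq> adjacent_transpositions n"
      and w: "w \<in> shortest_reps n (cuts n I) (cuts n J)"
      using x unfolding x_eq two_sided_coxeter_complex_sym_group_iff by blast+
    have I': "I' \<subseteq> adjacent_transpositions n" "J' \<subseteq> adjacent_transpositions n"
      and w': "w' \<in> shortest_reps n (cuts n I') (cuts n J')"
      using y unfolding y_eq two_sided_coxeter_complex_sym_group_iff by blast+
    have tables: "table n (cuts n I) w (cuts n J) = table n (cuts n I') w' (cuts n J')"
      using eq by (simp add: x_eq y_eq table_of_def)
    have cuts: "cuts n I = cuts n I'" "cuts n J = cuts n J'"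
      using table_determines_cuts[OF cuts_subset cuts_subset cuts_subset cuts_subset
          shortest_repsD(1)[OF w] shortest_repsD(1)[OF w'] tables] by blast+
    then have "I = I'" "J = J'" using adj_image_cuts I I' by metis+
    moreover have "w = w'"
      using shortest_rep_unique[OF finite_cuts finite_cuts w] w' tables cuts by simp
    ultimately show "x = y" by (simp add: x_eq y_eq)
  qed
next
  show "table_of n ` ?X = contingency_tables n"
  proof (intro equalityI subsetI)
    fix A assume "A \<in> table_of n ` ?X"
    then obtain I w J where "(I, w, J) \<in> ?X" and A: "A = table_of n (I, w, J)" by auto
    then have "w permutes {1..n}"
      unfolding two_sided_coxeter_complex_sym_group_iff by (blast dest: shortest_repsD(1))
    then show "A \<in> contingency_tables n"
      unfolding A table_of_def prod.case
      by (rule table_in_contingency_tables[OF cuts_subset cuts_subset n])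
  next
    fix A assume "A \<in> contingency_tables n"
    then obtain C D w where C: "C \<subseteq> {1..<n}" and D: "D \<subseteq> {1..<n}"
      and w: "w permutes {1..n}" and A: "A = table n C w D"
      by (rule contingency_table_is_table)
    have "finite C" "finite D" using C D finite_subset by blast+
    then obtain v where v: "v \<in> shortest_reps n C D" "table n C v D = A"
      using shortest_rep_exists[OF _ _ w] A by metis
    let ?I = "adj ` ({1..<n} - C)" and ?J = "adj ` ({1..<n} - D)"
    have "?I \<subseteq> adjacent_transpositions n" "?J \<subseteq> adjacent_transpositions n"
      unfolding adjacent_transpositions_eq by blast+
    then have "(?I, v, ?J) \<in> ?X"
      unfolding two_sided_coxeter_complex_sym_group_iff cuts_adj_image[OF C] cuts_adj_image[OF D]
      using v by blast
    moreover have "table_of n (?I, v, ?J) = A"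
      unfolding table_of_def prod.case cuts_adj_image[OF C] cuts_adj_image[OF D] using v by blast
    ultimately show "A \<in> table_of n ` ?X" by blast
  qed
qed

text \<open>
  An order isomorphism transports the axioms of a partial order, so they need checking on one side
  only. For tables this avoids a direct proof that refinement is antisymmetric.
\<close>

lemma poset_isomorphicI:
  assumes bij: "bij_betw f A B"
    and le: "\<And>x y. x \<in> A \<Longrightarrow> y \<in> A \<Longrightarrow> le_A x y \<longleftrightarrow> le_B (f x) (f y)"
    and po: "partial_order_on A (relation_of le_A A)"
  shows "poset_isomorphic A le_A B le_B"
proof -
  have refl: "le_A a a" if "a \<in> A" for a
    using po that unfolding partial_order_on_def preorder_on_def refl_on_def relation_of_def by blast
  have trans: "le_A a c" if "a \<in> A" "b \<in> A" "c \<in> A" "le_A a b" "le_A b c" for a b c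
  proof -
    have "trans (relation_of le_A A)"
      using po unfolding partial_order_on_def preorder_on_def by blast
    moreover have "(a, b) \<in> relation_of le_A A" "(b, c) \<in> relation_of le_A A"
      using that by (simp_all add: relation_of_def)
    ultimately have "(a, c) \<in> relation_of le_A A" by (rule transD)
    then show ?thesis by (simp add: relation_of_def)
  qed
  have antisym: "a = b" if "a \<in> A" "b \<in> A" "le_A a b" "le_A b a" for a b
    using po that unfolding partial_order_on_def antisym_def relation_of_def by blast
  have B: "\<exists>a\<in>A. b = f a" if "b \<in> B" for b
    using bij_betw_imp_surj_on[OF bij] that by blast
  have "partial_order_on B (relation_of le_B B)"
  proof (rule partial_order_on_relation_ofI)
    fix a assume "a \<in> B"
    then show "le_B a a" using B le refl by blast
  next
    fix a b c assume "a \<in> B" "b \<in> B" "c \<in> B" and ab: "le_B a b" "le_B b c"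
    then obtain a' b' c' where "a' \<in> A" "b' \<in> A" "c' \<in> A" "a = f a'" "b = f b'" "c = f c'"
      using B by metis
    then show "le_B a c" using ab le trans by metis
  next
    fix a b assume "a \<in> B" "b \<in> B" and ab: "le_B a b" "le_B b a"
    then obtain a' b' where "a' \<in> A" "b' \<in> A" "a = f a'" "b = f b'" using B by metis
    then show "a = b" using ab le antisym by metis
  qed
  then show ?thesis unfolding poset_isomorphic_def using bij le po by blast
qed

theorem proposition2:
  fixes n :: nat
  assumes "n \<ge> 1"
  shows "poset_isomorphic
           (two_sided_coxeter_complex (sym_group n) (adjacent_transpositions n))
           (two_sided_coxeter_le (sym_group n))
           (contingency_tables n)
           (refinement_le n)"
proof (rule poset_isomorphicI)
  show "bij_betw (table_of n)
    (two_sided_coxeter_complex (sym_group n) (adjacent_transpositions n)) (contingency_tables n)"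
    by (rule bij_betw_table_of[OF assms])
next
  fix x y
  assume "x \<in> two_sided_coxeter_complex (sym_group n) (adjacent_transpositions n)"
    "y \<in> two_sided_coxeter_complex (sym_group n) (adjacent_transpositions n)"
  then show "two_sided_coxeter_le (sym_group n) x y \<longleftrightarrow> refinement_le n (table_of n x) (table_of n y)"
    by (rule coxeter_le_iff_refinement_le[OF assms])
next
  let ?X = "two_sided_coxeter_complex (sym_group n) (adjacent_transpositions n)"
  show "partial_order_on ?X (relation_of (two_sided_coxeter_le (sym_group n)) ?X)"
  proof (rule partial_order_on_relation_ofI)
    fix x y assume x: "x \<in> ?X" and y: "y \<in> ?X"
      and le: "two_sided_coxeter_le (sym_group n) x y" "two_sided_coxeter_le (sym_group n) y x"
    obtain I w J where x_eq: "x = (I, w, J)" by (cases x) auto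
    obtain I' w' J' where y_eq: "y = (I', w', J')" by (cases y) auto
    have I: "I \<subseteq> adjacent_transpositions n" "J \<subseteq> adjacent_transpositions n"
      and w: "w permutes {1..n}"
      using x unfolding x_eq two_sided_coxeter_complex_sym_group_iff by (blast dest: shortest_repsD(1))+
    have w': "w' permutes {1..n}"
      using y unfolding y_eq two_sided_coxeter_complex_sym_group_iff by (blast dest: shortest_repsD(1))
    have le': "I' \<subseteq> I \<and> J' \<subseteq> J \<and>
        parabolic_double_coset (sym_group n) I' w' J' \<subseteq> parabolic_double_coset (sym_group n) I w J"
      "I \<subseteq> I' \<and> J \<subseteq> J' \<and>
        parabolic_double_coset (sym_group n) I w J \<subseteq> parabolic_double_coset (sym_group n) I' w' J'"
      using le unfolding x_eq y_eq two_sided_coxeter_le_def prod.case .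
    have eqs: "I' = I" "J' = J"
      by (rule subset_antisym; use le' in \<open>simp only:\<close>)+
    have coset: "parabolic_double_coset (sym_group n) I w J = parabolic_double_coset (sym_group n) I w' J"
      by (rule subset_antisym) (use le' in \<open>simp_all only: eqs\<close>)
    have "w \<in> parabolic_double_coset (sym_group n) I w J"
      unfolding double_coset_sym_group[OF I w] using w by (simp only: mem_Collect_eq)
    then have "table_of n x = table_of n y"
      unfolding coset double_coset_sym_group[OF I w'] x_eq y_eq eqs by (simp only: mem_Collect_eq)
    with bij_betw_imp_inj_on[OF bij_betw_table_of[OF assms]] show "x = y"
      using x y by (rule inj_onD)
  next
    fix x y z
    assume "two_sided_coxeter_le (sym_group n) x y" "two_sided_coxeter_le (sym_group n) y z"
    then show "two_sided_coxeter_le (sym_group n) x z"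
      unfolding two_sided_coxeter_le_def by (cases x; cases y; cases z) auto
  qed (auto simp: two_sided_coxeter_le_def)
qed

end
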